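(* Let $d\ge 2$, let $0,\lambda_1,\dots,\lambda_d$ be the vertices of a regular simplex in $\mathbb{R}^d$, let $\Lambda=\bigoplus_{i=1}^d\mathbb{Z}\lambda_i$, and let $v=\frac{1}{d+1}\sum_{i=1}^d\lambda_i$. Let $F$ be the $d$-periodic framework with periodicity lattice $\Lambda$, with two vertex orbits $\Lambda$ and $v+\Lambda$, and with $2d+\binom{d}{2}$ edge orbits represented by the edges joining $v$ to the points $\lambda_i$ and $2\lambda_i$ ($1\le i\le d$) and $\lambda_i+\lambda_j$ ($1\le i<j\le d$). (1) For every $i\in\{1,\dots,d\}$, the framework $F_i$ obtained from $F$ by removing the edge orbit of the edge joining $v$ to $2\lambda_i$ is, locally, an expansive one-degree-of-freedom mechanism. (2) Consequently, the framework $F_0$ obtained from $F$ by removing all $d$ edge orbits of the edges joining $v$ to $2\lambda_i$, $i=1,\dots,d$, has $d$ degrees of freedom, and its infinitesimal expansive cone has exactly $d$ extremal rays, namely those given by the infinitesimal deformations of the expansive mechanisms $F_1,\dots,F_d$.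
   Context: A $d$-periodic framework here consists of an infinite graph with a free action of $\Gamma\cong\mathbb{Z}^d$ having finitely many vertex and edge orbits, a placement of the vertices in $\mathbb{R}^d$, and a faithful representation of $\Gamma$ by a rank $d$ lattice of translations compatible with the placement. For the frameworks in the claim, the vertices in the two orbits are placed at $\sum_k n_k\lambda_k$ and $v+\sum_k n_k\lambda_k$ ($n\in\mathbb{Z}^d$), and the edges are all $\Lambda$-translates of the listed representatives. A periodic deformation keeps the same abstract graph and group $\Gamma$ and all edge lengths, but both placement and lattice may vary. Up to translation (keeping the vertex at the origin fixed), a nearby configuration is given by vectors $(\lambda_1',\dots,\lambda_d',v')$ with $\lambda_1',\dots,\lambda_d'$ linearly independent, such that every representative edge from $v$ to $\sum_k n_k\lambda_k$ has the same length as before, i.e. $|v'-\sum_k n_k\lambda_k'|=|v-\sum_k n_k\lambda_k|$. The deformation space is the space of such configurations modulo Euclidean isometries (connected component of the given one). A framework has $k$ degrees of freedom if its deformation space is, near the given configuration, smooth of dimension $k$. A one-parameter deformation is expansive if all distances between pairs of joints (vertices) increase or stay the same whenever the parameter increases. The framework is locally an expansive one-degree-of-freedom mechanism if its deformation space near the given configuration is a smooth curve which, with a suitable parametrization on a sufficiently small parameter interval, is an expansive deformation. The infinitesimal expansive cone of a framework is the convex cone, in the tangent space of its deformation space at the given configuration, of those infinitesimal deformations for which the derivative of the squared distance between any two vertices is $\ge 0$. The deformation space of $F_i$ is contained in that of $F_0$; the ray given by the mechanism $F_i$ is the ray spanned by the velocity of its deformation in the expansive direction. *)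

theory Defs
  imports "HOL-Analysis.Analysis"
begin

section \<open>Smooth maps\<close>

primrec times_differentiable_on ::
  "nat \<Rightarrow> ('a::real_normed_vector \<Rightarrow> 'b::real_normed_vector) \<Rightarrow> 'a set \<Rightarrow> bool" where
  "times_differentiable_on 0 f U \<longleftrightarrow> continuous_on U f"
| "times_differentiable_on (Suc k) f U \<longleftrightarrow>
     (\<forall>x\<in>U. f differentiable (at x)) \<and>
     (\<forall>h. times_differentiable_on k (\<lambda>x. frechet_derivative f (at x) h) U)"

text \<open>The class $C^\infty$; only used for open \<open>U\<close>.\<close>

definition smooth_on ::
  "('a::real_normed_vector \<Rightarrow> 'b::real_normed_vector) \<Rightarrow> 'a set \<Rightarrow> bool" where
  "smooth_on f U \<longleftrightarrow> (\<forall>k. times_differentiable_on k f U)"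


section \<open>Periodic frameworks with two vertex orbits\<close>

text \<open>
  The dimension is $d = $ \<open>CARD('n)\<close>, and $\Gamma = {\bf Z}^d$ is \<open>int ^ 'n\<close>, acting on the
  joints by \<open>translate\<close>. \<open>Lattice n\<close> is the vertex to be placed at $\sum_k n_k\lambda_k$,
  \<open>Centre n\<close> the one to be placed at $v + \sum_k n_k\lambda_k$.
\<close>

datatype 'n joint = Lattice "int ^ 'n" | Centre "int ^ 'n"

primrec translate :: "int ^ 'n \<Rightarrow> 'n::finite joint \<Rightarrow> 'n joint" where
  "translate m (Lattice n) = Lattice (m + n)"
| "translate m (Centre n) = Centre (m + n)"

text \<open>
  A configuration $((\lambda_1,\dots,\lambda_d), v)$: a placement compatible with a
  representation of $\Gamma$ by translations, the vertex \<open>Lattice 0\<close> being at the origin.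
\<close>

type_synonym 'n config = "((real ^ 'n) ^ 'n) \<times> (real ^ 'n)"

primrec placement :: "'n::finite config \<Rightarrow> 'n joint \<Rightarrow> real ^ 'n" where
  "placement q (Lattice n) = (\<Sum>k\<in>UNIV. real_of_int (n $ k) *\<^sub>R (fst q $ k))"
| "placement q (Centre n) = snd q + (\<Sum>k\<in>UNIV. real_of_int (n $ k) *\<^sub>R (fst q $ k))"

text \<open>An edge is recorded as an ordered pair, with one fixed choice of the order.\<close>

type_synonym 'n edges = "('n joint \<times> 'n joint) set"

definition edge_orbit :: "'n::finite joint \<Rightarrow> 'n joint \<Rightarrow> 'n edges" where
  "edge_orbit a b = range (\<lambda>m. (translate m a, translate m b))"


section \<open>The deformation space\<close>

definition realizations :: "'n::finite edges \<Rightarrow> 'n config \<Rightarrow> 'n config set" where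
  "realizations E p =
     {q. inj (\<lambda>k. fst q $ k) \<and> independent (range (\<lambda>k. fst q $ k)) \<and>
         (\<forall>(a, b)\<in>E. dist (placement q a) (placement q b) = dist (placement p a) (placement p b))}"

definition congruent :: "'n::finite config \<Rightarrow> 'n config \<Rightarrow> bool" where
  "congruent q q' \<longleftrightarrow>
     (\<exists>T. (\<forall>x y. dist (T x) (T y) = dist x y) \<and> (\<forall>a. placement q' a = T (placement q a)))"

definition congruence_class ::
  "'n::finite edges \<Rightarrow> 'n config \<Rightarrow> 'n config \<Rightarrow> 'n config set" where
  "congruence_class E p q = {q' \<in> realizations E p. congruent q q'}"

text \<open>The quotient topology on the set of congruence classes of realizations.\<close>

definition configuration_space :: "'n::finite edges \<Rightarrow> 'n config \<Rightarrow> 'n config set topology" where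
  "configuration_space E p =
     topology (\<lambda>S. S \<subseteq> congruence_class E p ` realizations E p \<and>
       openin (top_of_set (realizations E p)) {q \<in> realizations E p. congruence_class E p q \<in> S})"

lemma openin_configuration_space:
  "openin (configuration_space E p) S \<longleftrightarrow>
     S \<subseteq> congruence_class E p ` realizations E p \<and>
     openin (top_of_set (realizations E p)) {q \<in> realizations E p. congruence_class E p q \<in> S}"
proof -
  define R where "R = realizations E p"
  define c where "c = congruence_class E p"
  define L where "L S \<longleftrightarrow> S \<subseteq> c ` R \<and> openin (top_of_set R) {q \<in> R. c q \<in> S}" for S
  have "L (S \<inter> T)" if "L S" "L T" for S T
  proof -
    have "{q \<in> R. c q \<in> S \<inter> T} = {q \<in> R. c q \<in> S} \<inter> {q \<in> R. c q \<in> T}"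
      by auto
    moreover have "openin (top_of_set R) ({q \<in> R. c q \<in> S} \<inter> {q \<in> R. c q \<in> T})"
      using that by (intro openin_Int) (simp_all add: L_def)
    ultimately show ?thesis
      using that by (simp add: L_def le_infI1)
  qed
  moreover have "L (\<Union>K)" if "\<forall>S\<in>K. L S" for K
  proof -
    have "{q \<in> R. c q \<in> \<Union>K} = \<Union>((\<lambda>S. {q \<in> R. c q \<in> S}) ` K)"
      by auto
    moreover have "openin (top_of_set R) (\<Union>((\<lambda>S. {q \<in> R. c q \<in> S}) ` K))"
      using that by (intro openin_Union) (auto simp: L_def)
    moreover have "\<Union>K \<subseteq> c ` R"
      using that by (intro Union_least) (simp add: L_def)
    ultimately show ?thesis
      by (simp only: L_def)
  qed
  ultimately have "istopology L"
    by (simp add: istopology_def)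
  then have "openin (topology L) = L"
    by (rule topology_inverse')
  moreover have "configuration_space E p = topology L"
    by (simp add: configuration_space_def L_def[abs_def] R_def c_def)
  ultimately show ?thesis
    by (simp add: L_def R_def c_def)
qed

definition deformation_space :: "'n::finite edges \<Rightarrow> 'n config \<Rightarrow> 'n config set topology" where
  "deformation_space E p =
     subtopology (configuration_space E p)
       (connected_component_of_set (configuration_space E p) (congruence_class E p p))"

text \<open>
  The tangent space at \<open>q\<close> of the orbit of \<open>q\<close> under isometries fixing the origin:
  the velocities induced by skew-symmetric linear maps.
\<close>

definition infinitesimal_rotations :: "'n::finite config \<Rightarrow> 'n config set" where
  "infinitesimal_rotations q =
     {(\<chi> k. A (fst q $ k), A (snd q)) | A. linear A \<and> (\<forall>x y. A x \<bullet> y = - (x \<bullet> A y))}"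

text \<open>
  A smooth parametrization of a neighbourhood of the class of \<open>p\<close> in the deformation space,
  given by a lift \<open>\<phi>\<close> to configurations. The orthogonal group acts freely and properly on the
  configurations, so the space of all their congruence classes is a smooth manifold whose tangent
  space at the class of \<open>q\<close> consists of the configuration vectors modulo
  \<open>infinitesimal_rotations q\<close>; the condition on the derivative says that the induced map
  into this manifold is an immersion.
\<close>

definition local_parametrization ::
  "'n::finite edges \<Rightarrow> 'n config \<Rightarrow> 'k::euclidean_space set \<Rightarrow> ('k \<Rightarrow> 'n config) \<Rightarrow> bool" where
  "local_parametrization E p U \<phi> \<longleftrightarrow>
     open U \<and> 0 \<in> U \<and> \<phi> 0 = p \<and> \<phi> ` U \<subseteq> realizations E p \<and>
     smooth_on \<phi> U \<and>
     (\<forall>u\<in>U. \<forall>h. frechet_derivative \<phi> (at u) h \<in> infinitesimal_rotations (\<phi> u) \<longrightarrow> h = 0) \<and>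
     embedding_map (top_of_set U) (deformation_space E p) (\<lambda>u. congruence_class E p (\<phi> u)) \<and>
     openin (deformation_space E p) ((\<lambda>u. congruence_class E p (\<phi> u)) ` U)"

text \<open>The number of degrees of freedom is \<open>DIM('k)\<close>.\<close>

definition has_degrees_of_freedom ::
  "'n::finite edges \<Rightarrow> 'n config \<Rightarrow> 'k::euclidean_space itself \<Rightarrow> bool" where
  "has_degrees_of_freedom E p _ \<longleftrightarrow>
     (\<exists>(U :: 'k set) \<phi>. local_parametrization E p U \<phi>)"


section \<open>Expansive mechanisms\<close>

definition expansive_on :: "real set \<Rightarrow> (real \<Rightarrow> 'n::finite config) \<Rightarrow> bool" where
  "expansive_on I \<phi> \<longleftrightarrow>
     (\<forall>a b. mono_on I (\<lambda>t. dist (placement (\<phi> t) a) (placement (\<phi> t) b)))"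

definition expansive_parametrization ::
  "'n::finite edges \<Rightarrow> 'n config \<Rightarrow> real \<Rightarrow> (real \<Rightarrow> 'n config) \<Rightarrow> bool" where
  "expansive_parametrization E p e \<phi> \<longleftrightarrow>
     0 < e \<and> local_parametrization E p {-e<..<e} \<phi> \<and> expansive_on {-e<..<e} \<phi>"

definition expansive_one_dof_mechanism :: "'n::finite edges \<Rightarrow> 'n config \<Rightarrow> bool" where
  "expansive_one_dof_mechanism E p \<longleftrightarrow> (\<exists>e \<phi>. expansive_parametrization E p e \<phi>)"

definition expansive_velocity :: "'n::finite edges \<Rightarrow> 'n config \<Rightarrow> 'n config \<Rightarrow> bool" where
  "expansive_velocity E p w \<longleftrightarrow>
     (\<exists>e \<phi>. expansive_parametrization E p e \<phi> \<and> (\<phi> has_vector_derivative w) (at 0))"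


section \<open>The infinitesimal expansive cone\<close>

text \<open>
  The tangent space of the deformation space at the class of \<open>p\<close> is a space of vectors modulo
  \<open>infinitesimal_rotations p\<close>. It and its subsets are represented by their full preimages
  in the space of configuration vectors; faces of the cone correspond bijectively to faces of
  its preimage.
\<close>

definition infinitesimal_deformations :: "'n::finite edges \<Rightarrow> 'n config \<Rightarrow> 'n config set" where
  "infinitesimal_deformations E p =
     {w + r | w r. r \<in> infinitesimal_rotations p \<and>
        (\<exists>e>0. \<exists>\<gamma>. smooth_on \<gamma> {-e<..<e} \<and> \<gamma> 0 = p \<and> \<gamma> ` {-e<..<e} \<subseteq> realizations E p \<and>
           (\<gamma> has_vector_derivative w) (at 0))}"

definition expansive_cone :: "'n::finite edges \<Rightarrow> 'n config \<Rightarrow> 'n config set" where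
  "expansive_cone E p =
     {w \<in> infinitesimal_deformations E p.
        \<forall>a b. 0 \<le> frechet_derivative (\<lambda>q. (dist (placement q a) (placement q b))\<^sup>2) (at p) w}"

definition deformation_ray :: "'n::finite config \<Rightarrow> 'n config \<Rightarrow> 'n config set" where
  "deformation_ray p w = {c *\<^sub>R w + r | c r. 0 \<le> c \<and> r \<in> infinitesimal_rotations p}"

definition extremal_rays :: "'n::finite config \<Rightarrow> 'n config set \<Rightarrow> 'n config set set" where
  "extremal_rays p C =
     {R. R face_of C \<and> (\<exists>w. w \<in> C \<and> w \<notin> infinitesimal_rotations p \<and> R = deformation_ray p w)}"


section \<open>The simplicial frameworks\<close>

definition regular_simplex_vertices :: "nat \<Rightarrow> 'a::euclidean_space set \<Rightarrow> bool" where
  "regular_simplex_vertices d V \<longleftrightarrow>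
     card V = d + 1 \<and> \<not> affine_dependent V \<and>
     (\<exists>l. \<forall>x\<in>V. \<forall>y\<in>V. x \<noteq> y \<longrightarrow> dist x y = l)"

definition simplex_configuration :: "('n::finite \<Rightarrow> real ^ 'n) \<Rightarrow> 'n config" where
  "simplex_configuration lam =
     (\<chi> k. lam k, (1 / (real CARD('n) + 1)) *\<^sub>R (\<Sum>k\<in>UNIV. lam k))"

definition centre_edge_orbit :: "int ^ 'n \<Rightarrow> 'n::finite edges" where
  "centre_edge_orbit n = edge_orbit (Centre 0) (Lattice n)"

definition edges_F :: "'n::finite edges" where
  "edges_F =
     (\<Union>i. centre_edge_orbit (axis i 1)) \<union>
     (\<Union>i. centre_edge_orbit (axis i 2)) \<union>
     (\<Union>(i, j)\<in>{(i, j). i \<noteq> j}. centre_edge_orbit (axis i 1 + axis j 1))"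

definition edges_F_without :: "'n::finite \<Rightarrow> 'n edges" where
  "edges_F_without i = edges_F - centre_edge_orbit (axis i 2)"

definition edges_F0 :: "'n::finite edges" where
  "edges_F0 = edges_F - (\<Union>i. centre_edge_orbit (axis i 2))"

end

theory Submission
  imports Defs
begin

text \<open>
  A configuration of \<open>F\<^sub>0\<close> is determined up to isometry by the changes \<open>y\<^sub>i\<close> of the squared
  lengths of the removed edges. Indeed, preserving the remaining edge lengths forces the squared
  length of $\sum_k n_k \lambda_k - s v$ to change by
  \[ \frac{1}{2} \Bigl( S (s - N)(2s - N) + \sum_i y_i n_i (n_i - s) \Bigr), \qquad N = \sum_k n_k, \]
  where $S$ is the change of $|v|^2$. As the centre stays inside the simplex, a suitable polarization
  of this identity at the linear relations satisfied by $v$ and the periods expresses $S$ as a positive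
  combination of the $y_i$. For integral $n_i$ and $s \in \{0, 1\}$ all coefficients are nonnegative, so
  that no distance decreases as long as no $y_i$ does; the expansive cone is the orthant $y \ge 0$,
  whose extremal rays are the coordinate axes, followed by the mechanisms $F_i$. A family of realizations
  with given $y$ is obtained by inverting a quadratic map.
\<close>

section \<open>Smooth local inverses of quadratic maps\<close>

text \<open>The change of the Gram matrix of the periods and v is a symmetric form in d + 1
  variables. Its (d + 1)(d + 2)/2 coefficients satisfy d + d(d - 1)/2 linear conditions, one for
  each edge orbit of F_0, and this leaves the d + 1 parameters S, y_1, ..., y_d. The relation that
  eliminates S is the linear dependence of d + 1 vectors in d-space. The obstacle is that this
  dependence varies with the configuration, with coefficients t at one realization and t' at
  another. The form is therefore polarized at the pair (t, t'): t annihilates one of the two Gram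
  forms and t' the other, so their difference vanishes there exactly. Two realizations are compared
  directly in this way, and distances are seen to be monotone along a motion without integrating
  derivatives. To realize a given y, the removed lengths, the other lengths and a normalization of
  the rotation are collected into one quadratic map between spaces of equal dimension d^2 +
  d.\<close>

lemma times_differentiable_on_cong:
  assumes "open U" "\<And>x. x \<in> U \<Longrightarrow> f x = g x" "times_differentiable_on k f U"
  shows "times_differentiable_on k g U"
  using assms(2,3)
proof (induction k arbitrary: f g)
  case 0
  then show ?case
    using continuous_on_cong by (metis times_differentiable_on.simps(1))
next
  case (Suc k)
  have eq: "frechet_derivative f (at x) = frechet_derivative g (at x)"
    and diff: "g differentiable at x" if "x \<in> U" for x
  proof -
    have "(f has_derivative frechet_derivative f (at x)) (at x)"
      using Suc.prems that by (simp add: frechet_derivative_works[symmetric])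
    then have "(g has_derivative frechet_derivative f (at x)) (at x)"
      by (rule has_derivative_transform_within_open[OF _ assms(1) that]) (use Suc.prems in auto)
    then show "frechet_derivative f (at x) = frechet_derivative g (at x)" "g differentiable at x"
      by (auto intro: frechet_derivative_at differentiableI)
  qed
  have "times_differentiable_on k (\<lambda>x. frechet_derivative g (at x) h) U" for h
    by (rule Suc.IH[where f = "\<lambda>x. frechet_derivative f (at x) h"]) (use Suc.prems eq in auto)
  then show ?case
    using diff by simp
qed

text \<open>Lets inductions on the order run on an explicit formula for the derivative instead of
  \<open>frechet_derivative\<close>.\<close>

lemma times_differentiable_on_SucI:
  assumes "open U" "\<And>x. x \<in> U \<Longrightarrow> (f has_derivative f' x) (at x)"
    "\<And>h. times_differentiable_on k (\<lambda>x. f' x h) U"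
  shows "times_differentiable_on (Suc k) f U"
proof -
  have "f' x = frechet_derivative f (at x)" if "x \<in> U" for x
    using assms(2)[OF that] by (rule frechet_derivative_at)
  then have "times_differentiable_on k (\<lambda>x. frechet_derivative f (at x) h) U" for h
    by (intro times_differentiable_on_cong[OF assms(1) _ assms(3)]) auto
  then show ?thesis
    using assms(2) by (auto intro: differentiableI)
qed

lemma times_differentiable_on_SucD:
  assumes "times_differentiable_on (Suc k) f U"
  shows "\<And>x. x \<in> U \<Longrightarrow> (f has_derivative frechet_derivative f (at x)) (at x)"
    and "\<And>h. times_differentiable_on k (\<lambda>x. frechet_derivative f (at x) h) U"
  using assms by (auto simp: frechet_derivative_works[symmetric])

lemma times_differentiable_on_Suc_imp:
  "times_differentiable_on (Suc k) f U \<Longrightarrow> times_differentiable_on k f U"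
proof (induction k arbitrary: f)
  case 0
  then show ?case
    by (auto intro!: continuous_at_imp_continuous_on differentiable_imp_continuous_within)
next
  case (Suc k)
  then show ?case
    by (metis times_differentiable_on.simps(2))
qed

lemma times_differentiable_on_const:
  assumes "open U"
  shows "times_differentiable_on k (\<lambda>x. c) U"
proof (induction k arbitrary: c)
  case (Suc k)
  show ?case
    by (rule times_differentiable_on_SucI[OF assms, where f' = "\<lambda>x h. 0"]) (auto intro: Suc)
qed auto

lemma times_differentiable_on_bounded_linear:
  assumes "bounded_linear L" "open U" "times_differentiable_on k f U"
  shows "times_differentiable_on k (\<lambda>x. L (f x)) U"
  using assms(3)
proof (induction k arbitrary: f)
  case 0
  then show ?case
    by (simp add: bounded_linear.continuous_on[OF assms(1)])
next
  case (Suc k)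
  show ?case
    by (rule times_differentiable_on_SucI[OF assms(2),
          where f' = "\<lambda>x h. L (frechet_derivative f (at x) h)"])
      (use Suc.IH times_differentiable_on_SucD[OF Suc.prems] in
        \<open>auto intro: bounded_linear.has_derivative[OF assms(1)]\<close>)
qed

lemma times_differentiable_on_add:
  assumes "open U" "times_differentiable_on k f U" "times_differentiable_on k g U"
  shows "times_differentiable_on k (\<lambda>x. f x + g x) U"
  using assms(2,3)
proof (induction k arbitrary: f g)
  case 0
  then show ?case
    by (simp add: continuous_on_add)
next
  case (Suc k)
  show ?case
    by (rule times_differentiable_on_SucI[OF assms(1), where
          f' = "\<lambda>x h. frechet_derivative f (at x) h + frechet_derivative g (at x) h"])
      (use Suc.IH times_differentiable_on_SucD[OF Suc.prems(1)]
        times_differentiable_on_SucD[OF Suc.prems(2)] in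
        \<open>auto intro: has_derivative_add\<close>)
qed

lemma times_differentiable_on_sum:
  assumes "open U" "\<And>i. i \<in> I \<Longrightarrow> times_differentiable_on k (f i) U"
  shows "times_differentiable_on k (\<lambda>x. \<Sum>i\<in>I. f i x) U"
  using assms(2)
  by (induction I rule: infinite_finite_induct)
    (simp_all add: assms(1) times_differentiable_on_add times_differentiable_on_const)

lemma times_differentiable_on_bilinear:
  assumes "bounded_bilinear pr" "open U"
    "times_differentiable_on k f U" "times_differentiable_on k g U"
  shows "times_differentiable_on k (\<lambda>x. pr (f x) (g x)) U"
  using assms(3,4)
proof (induction k arbitrary: f g)
  case 0
  then show ?case
    by (simp add: bounded_bilinear.continuous_on[OF assms(1)])
next
  case (Suc k)
  show ?case
    by (rule times_differentiable_on_SucI[OF assms(2), where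
          f' = "\<lambda>x h. pr (f x) (frechet_derivative g (at x) h)
            + pr (frechet_derivative f (at x) h) (g x)"])
      (use times_differentiable_on_SucD[OF Suc.prems(1)] times_differentiable_on_SucD[OF Suc.prems(2)]
        times_differentiable_on_Suc_imp[OF Suc.prems(1)] times_differentiable_on_Suc_imp[OF Suc.prems(2)] in
        \<open>auto intro!: bounded_bilinear.FDERIV[OF assms(1)] times_differentiable_on_add[OF assms(2)]
          Suc.IH\<close>)
qed

text \<open>For an affine inner map the derivative of the composition in direction \<open>h\<close>
  is the derivative of \<open>f\<close> in the fixed direction \<open>L h\<close>, composed with the
  same affine map. So the induction hypothesis applies to it as it stands.\<close>

lemma times_differentiable_on_affine_compose:
  assumes "bounded_linear L" "open U" "\<And>x. x \<in> U \<Longrightarrow> a + L x \<in> V" "times_differentiable_on k f V"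
  shows "times_differentiable_on k (\<lambda>x. f (a + L x)) U"
  using assms(4)
proof (induction k arbitrary: f)
  case 0
  have "continuous_on U (\<lambda>x. a + L x)"
    by (intro continuous_intros bounded_linear.continuous_on[OF assms(1)])
  then show ?case
    using 0 assms(3) by (auto intro!: continuous_on_compose2[of V f U])
next
  case (Suc k)
  have aff: "((\<lambda>x. a + L x) has_derivative L) (at x)" for x
    using bounded_linear_imp_has_derivative[OF assms(1)] by (auto intro!: derivative_eq_intros)
  show ?case
  proof (rule times_differentiable_on_SucI[OF assms(2), where
        f' = "\<lambda>x h. frechet_derivative f (at (a + L x)) (L h)"])
    show "((\<lambda>x. f (a + L x)) has_derivative (\<lambda>h. frechet_derivative f (at (a + L x)) (L h))) (at x)"
      if "x \<in> U" for x
      using has_derivative_compose[OF aff times_differentiable_on_SucD(1)[OF Suc.prems assms(3)[OF that]]]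
      by simp
    show "times_differentiable_on k (\<lambda>x. frechet_derivative f (at (a + L x)) (L h)) U" for h
      using Suc.IH[OF times_differentiable_on_SucD(2)[OF Suc.prems]] by simp
  qed
qed

lemma smooth_on_imp_has_derivative:
  assumes "smooth_on f U" "x \<in> U"
  shows "(f has_derivative frechet_derivative f (at x)) (at x)"
  using assms times_differentiable_on_SucD(1)[of 0] unfolding smooth_on_def by metis

lemma smooth_on_imp_continuous_on: "smooth_on f U \<Longrightarrow> continuous_on U f"
  unfolding smooth_on_def by (metis times_differentiable_on.simps(1))

lemma smooth_on_affine_compose:
  assumes "bounded_linear L" "open U" "\<And>x. x \<in> U \<Longrightarrow> a + L x \<in> V" "smooth_on f V"
  shows "smooth_on (\<lambda>x. f (a + L x)) U"
  using assms times_differentiable_on_affine_compose unfolding smooth_on_def by blast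

text \<open>The derivative \<open>L h + 2 *\<^sub>R B x h\<close> depends continuously on
  \<open>x\<close>, so the inverse function theorem applies. Smoothness follows because the
  derivative \<open>g'\<close> of the inverse satisfies a closed equation:
  \<open>\<lambda>y. g' y b\<close> has the derivative
  \<open>\<lambda>k. - g' y (2 *\<^sub>R B (g' y k) (g' y b))\<close>, an expression in
  \<open>g'\<close> alone, which raises the order step by step.\<close>

lemma quadratic_map_smooth_local_inverse:
  fixes L :: "'a::euclidean_space \<Rightarrow> 'a" and B :: "'a \<Rightarrow> 'a \<Rightarrow> 'a"
  assumes "linear L" "bilinear B" "\<And>x y. B x y = B y x"
    and inj: "\<And>h. L h + 2 *\<^sub>R B x0 h = 0 \<Longrightarrow> h = 0"
  obtains V g where "open V" "L x0 + B x0 x0 \<in> V" "g (L x0 + B x0 x0) = x0" "smooth_on g V"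
    "\<And>y. y \<in> V \<Longrightarrow> L (g y) + B (g y) (g y) = y"
proof -
  interpret L: bounded_linear L
    using assms(1) by (simp add: linear_conv_bounded_linear)
  interpret B: bounded_bilinear B
    using assms(2) by (simp add: bilinear_conv_bounded_bilinear)
  define f where "f x = L x + B x x" for x
  define T where "T x h = L h + 2 *\<^sub>R B x h" for x h
  have T_bl: "bounded_linear (T x)" for x
    unfolding T_def[abs_def]
    by (intro bounded_linear_add L.bounded_linear_axioms bounded_linear_const_scaleR
        B.bounded_linear_right)
  have derf: "(f has_derivative T x) (at x)" for x
    unfolding f_def[abs_def] T_def[abs_def]
    by (auto intro!: derivative_eq_intros L.has_derivative B.FDERIV
        simp: assms(3)[of x] scaleR_2)
  define F where "F x = Blinfun (T x)" for x
  have F: "blinfun_apply (F x) = T x" for x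
    unfolding F_def by (rule bounded_linear_Blinfun_apply[OF T_bl])
  have contF: "continuous_on UNIV F"
  proof (rule continuous_on_blinfun_componentwise)
    fix i :: 'a
    show "continuous_on UNIV (\<lambda>x. blinfun_apply (F x) i)"
      unfolding F T_def by (intro continuous_intros B.continuous_on)
  qed
  have "inj (T x0)"
    using inj unfolding linear_injective_0[OF bounded_linear.linear[OF T_bl]] T_def by blast
  then obtain S where S: "linear S" "S \<circ> T x0 = id"
    using linear_injective_left_inverse[OF bounded_linear.linear[OF T_bl]] by blast
  have "Blinfun S o\<^sub>L F x0 = id_blinfun"
    by (rule blinfun_eqI)
      (use S in \<open>simp add: F bounded_linear_Blinfun_apply linear_conv_bounded_linear o_def fun_eq_iff\<close>)
  from inverse_function_theorem[of UNIV f F x0 "Blinfun S", OF open_UNIV _ contF UNIV_I this]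
  obtain U' V g g' where V: "open V" "f x0 \<in> V" "x0 \<in> U'" and hom: "homeomorphism U' V f g"
    and derg: "\<And>y. y \<in> V \<Longrightarrow> (g has_derivative (g' y)) (at y)"
    and g': "\<And>y. y \<in> V \<Longrightarrow> g' y = inv (T (g y))"
    and bij: "\<And>y. y \<in> V \<Longrightarrow> bij (T (g y))"
    unfolding F using derf by metis
  have fg: "f (g y) = y" if "y \<in> V" for y
    using hom that by (meson homeomorphism_def)
  have Tg': "T (g y) (g' y b) = b" and g'T: "g' y (T (g y) b) = b" if "y \<in> V" for y b
    using bij[OF that] by (simp_all add: g'[OF that] bij_is_surj surj_f_inv_f bij_is_inj inv_f_f)
  have g'_bl: "bounded_linear (g' y)" if "y \<in> V" for y
    using derg[OF that] by (rule has_derivative_bounded_linear)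
  have contg: "continuous (at y) g" if "y \<in> V" for y
    using derg[OF that] has_derivative_continuous by blast
  text \<open>The map \<open>(x, h) \<mapsto> (f x, T x h)\<close> has the inverse \<open>(y, b) \<mapsto> (g y, g' y b)\<close>, so that the
    differentiability of \<open>g'\<close> is that of an inverse map.\<close>
  define G where "G z = (g (fst z), g' (fst z) (snd z))" for z
  have contG: "continuous (at (y, b)) G" if y: "y \<in> V" for y b
  proof -
    obtain C where C: "C > 0" "\<And>x. norm (g' y x) \<le> norm x * C"
      using bounded_linear.pos_bounded[OF g'_bl[OF y]] by blast
    obtain K where K: "K > 0" "\<And>a b. norm (B a b) \<le> norm a * norm b * K"
      using B.pos_bounded by blast
    have fst_lim: "((\<lambda>z. g (fst z)) \<longlongrightarrow> g y) (at (y, b))"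
      using isCont_tendsto_compose[OF contg[OF y] tendsto_fst[OF tendsto_ident_at[of "(y, b)" UNIV], simplified]] .
    then have "((\<lambda>z. 2 * (norm (g (fst z) - g y) * K) * C) \<longlongrightarrow> 2 * (norm (g y - g y) * K) * C) (at (y, b))"
      by (intro tendsto_intros)
    \<comment> \<open>\<open>C\<close> bounds \<open>g' y\<close> and \<open>K\<close> bounds
      \<open>B\<close>. The threshold 1/2 allows the error of replacing \<open>T (g y)\<close> by
      \<open>T (g (fst z))\<close> to be absorbed into the left side of the estimate of
      \<open>norm h\<close> below, at the price of a factor 2.\<close>
    then have ev: "\<forall>\<^sub>F z in at (y, b). 2 * (norm (g (fst z) - g y) * K) * C < 1 / 2"
      by (rule order_tendstoD) simp
    have evV: "\<forall>\<^sub>F z in at (y, b). z \<in> V \<times> UNIV"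
      by (rule eventually_at_in_open') (use V y in \<open>auto simp: open_Times\<close>)
    have "\<forall>\<^sub>F z in at (y, b). norm (g' (fst z) (snd z) - g' y b)
        \<le> 2 * C * norm (snd z - T (g (fst z)) (g' y b))"
      using ev evV
    proof eventually_elim
      case (elim z)
      define h where "h = g' (fst z) (snd z) - g' y b"
      have V': "fst z \<in> V"
        using elim by auto
      have Th: "T (g (fst z)) h = snd z - T (g (fst z)) (g' y b)"
        unfolding h_def by (simp add: linear_diff[OF bounded_linear.linear[OF T_bl]] Tg'[OF V'])
      have "T (g y) h = T (g (fst z)) h - 2 *\<^sub>R B (g (fst z) - g y) h"
        by (simp add: T_def B.diff_left scaleR_diff_right)
      then have "norm (T (g y) h) \<le> norm (T (g (fst z)) h) + 2 * (norm (g (fst z) - g y) * norm h * K)"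
        using norm_triangle_ineq4[of "T (g (fst z)) h" "2 *\<^sub>R B (g (fst z) - g y) h"]
          K(2)[of "g (fst z) - g y" h] by simp
      then have "norm h \<le> (norm (T (g (fst z)) h) + 2 * (norm (g (fst z) - g y) * norm h * K)) * C"
        using C(2)[of "T (g y) h"] C(1) g'T[OF y] by (smt (verit) mult_right_mono)
      also have "\<dots> = C * norm (T (g (fst z)) h) + (2 * (norm (g (fst z) - g y) * K) * C) * norm h"
        by (simp add: algebra_simps)
      also have "\<dots> \<le> C * norm (T (g (fst z)) h) + 1 / 2 * norm h"
        using elim(1) by (intro add_left_mono mult_right_mono) auto
      finally show ?case
        unfolding h_def[symmetric] Th by simp
    qed
    moreover have "((\<lambda>z. 2 * C * norm (snd z - T (g (fst z)) (g' y b))) \<longlongrightarrow>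
        2 * C * norm (b - T (g y) (g' y b))) (at (y, b))"
      unfolding T_def by (intro tendsto_intros fst_lim B.tendsto) (auto intro!: tendsto_eq_intros)
    ultimately have "((\<lambda>z. g' (fst z) (snd z) - g' y b) \<longlongrightarrow> 0) (at (y, b))"
      unfolding Tg'[OF y] diff_self norm_zero mult_zero_right by (rule Lim_null_comparison)
    then have "((\<lambda>z. g' (fst z) (snd z)) \<longlongrightarrow> g' y b) (at (y, b))"
      by (rule LIM_zero_cancel)
    then show ?thesis
      unfolding continuous_within G_def using fst_lim by (auto intro: tendsto_Pair)
  qed
  have der_g': "((\<lambda>y. g' y b) has_derivative (\<lambda>k. - g' y (2 *\<^sub>R B (g' y k) (g' y b)))) (at y)"
    if y: "y \<in> V" for y b
  proof -
    let ?H = "\<lambda>z. (f (fst z), T (fst z) (snd z))"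
    let ?x = "g y" and ?h = "g' y b"
    have "(?H has_derivative (\<lambda>d. (T ?x (fst d), T ?x (snd d) + 2 *\<^sub>R B (fst d) ?h))) (at (?x, ?h))"
    proof (rule has_derivative_Pair)
      show "((\<lambda>z. f (fst z)) has_derivative (\<lambda>d. T ?x (fst d))) (at (?x, ?h))"
        by (rule has_derivative_compose[OF has_derivative_fst[OF has_derivative_ident]])
          (simp add: derf)
      show "((\<lambda>z. T (fst z) (snd z)) has_derivative (\<lambda>d. T ?x (snd d) + 2 *\<^sub>R B (fst d) ?h)) (at (?x, ?h))"
        unfolding T_def
        by (auto intro!: derivative_eq_intros L.has_derivative B.FDERIV simp: algebra_simps)
    qed
    then have H: "(?H has_derivative (\<lambda>d. (T ?x (fst d), T ?x (snd d) + 2 *\<^sub>R B (fst d) ?h)))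
        (at (G (y, b)))"
      by (simp add: G_def)
    \<comment> \<open>The derivative of \<open>?H\<close> is block triangular, its first component
      involving \<open>fst d\<close> only. Back substitution gives the inverse map used
      here.\<close>
    have "(G has_derivative (\<lambda>d. (g' y (fst d), g' y (snd d - 2 *\<^sub>R B (g' y (fst d)) ?h)))) (at (y, b))"
    proof (rule has_derivative_inverse_basic[OF H _ _ contG[OF y]])
      show "bounded_linear (\<lambda>d. (g' y (fst d), g' y (snd d - 2 *\<^sub>R B (g' y (fst d)) ?h)))"
        by (intro bounded_linear_Pair bounded_linear_compose[OF g'_bl[OF y]] bounded_linear_sub
            bounded_linear_fst bounded_linear_snd bounded_linear_const_scaleR
            bounded_linear_compose[OF B.bounded_linear_left])
      show "(\<lambda>d. (g' y (fst d), g' y (snd d - 2 *\<^sub>R B (g' y (fst d)) ?h))) \<circ>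
          (\<lambda>d. (T ?x (fst d), T ?x (snd d) + 2 *\<^sub>R B (fst d) ?h)) = id"
        by (auto simp: fun_eq_iff g'T[OF y])
      show "open (V \<times> (UNIV :: 'a set))"
        using V by (simp add: open_Times)
    qed (use y in \<open>auto simp: G_def fg Tg'\<close>)
    then have "((\<lambda>z. snd (G z)) has_derivative (\<lambda>d. g' y (snd d - 2 *\<^sub>R B (g' y (fst d)) ?h))) (at (y, b))"
      using has_derivative_snd by fastforce
    moreover have "((\<lambda>y. (y, b)) has_derivative (\<lambda>k. (k, 0))) (at y)"
      by (auto intro!: derivative_eq_intros)
    ultimately have "((\<lambda>y. snd (G (y, b))) has_derivative (\<lambda>k. g' y (0 - 2 *\<^sub>R B (g' y k) ?h))) (at y)"
      using has_derivative_compose[where f = "\<lambda>y. (y, b)" and g = "\<lambda>z. snd (G z)"] by fastforce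
    then show ?thesis
      by (simp add: G_def linear_neg[OF bounded_linear.linear, OF g'_bl[OF y]])
  qed
  have "times_differentiable_on k (\<lambda>y. g' y b) V" for k b
  proof (induction k arbitrary: b)
    case 0
    have "continuous (at y) (\<lambda>y. g' y b)" if "y \<in> V" for y
      using der_g'[OF that] has_derivative_continuous by blast
    then show ?case
      by (simp add: continuous_at_imp_continuous_on)
  next
    case (Suc k)
    show ?case
    proof (rule times_differentiable_on_SucI[OF V(1) der_g'])
      fix h
      \<comment> \<open>\<open>g' y\<close> is applied to a vector that itself varies with
        \<open>y\<close>. Expanding this vector in \<open>Basis\<close> leaves only the maps
        \<open>g' y j\<close> with fixed \<open>j\<close>, which the induction hypothesis
        covers.\<close>
      have "times_differentiable_on k
          (\<lambda>y. \<Sum>j\<in>Basis. ((- 2) *\<^sub>R B (g' y h) (g' y b) \<bullet> j) *\<^sub>R g' y j) V"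
        by (intro times_differentiable_on_sum V(1) Suc
            times_differentiable_on_bilinear[OF bounded_bilinear_scaleR]
            times_differentiable_on_bilinear[OF B.bounded_bilinear_axioms]
            times_differentiable_on_bounded_linear[OF bounded_linear_inner_left]
            times_differentiable_on_bounded_linear[OF bounded_linear_scaleR_right])
      moreover have "(\<Sum>j\<in>Basis. ((- 2) *\<^sub>R B (g' y h) (g' y b) \<bullet> j) *\<^sub>R g' y j)
          = - g' y (2 *\<^sub>R B (g' y h) (g' y b))" if "y \<in> V" for y
      proof -
        interpret g': bounded_linear "g' y"
          using g'_bl[OF that] .
        show ?thesis
          by (simp only: g'.scaleR[symmetric] g'.sum[symmetric] euclidean_representation
              g'.neg[symmetric] scaleR_minus_left)
      qed
      ultimately show "times_differentiable_on k (\<lambda>y. - g' y (2 *\<^sub>R B (g' y h) (g' y b))) V"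
        by (rule times_differentiable_on_cong[OF V(1), rotated])
    qed
  qed
  then have "times_differentiable_on (Suc k) g V" for k
    by (intro times_differentiable_on_SucI[OF V(1) derg])
  then have "smooth_on g V"
    unfolding smooth_on_def using times_differentiable_on_Suc_imp by blast
  moreover have "g (f x0) = x0"
    using hom V(3) by (meson homeomorphism_def)
  ultimately show thesis
    using that[of V g] V fg by (simp add: f_def)
qed

section \<open>Variation of the Gram matrix\<close>

definition of_int_vec :: "int ^ 'n \<Rightarrow> real ^ 'n" where
  "of_int_vec n = (\<chi> k. real_of_int (n $ k))"

definition coeff_sum :: "real ^ 'n::finite \<Rightarrow> real" where
  "coeff_sum c = (\<Sum>k\<in>UNIV. c $ k)"

text \<open>Real coefficients are allowed so that the relation expressing the centre by the periods
  is included: it reads \<open>comb q t 1 = 0\<close>. With this sign the edge from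
  \<open>Centre 0\<close> to \<open>Lattice n\<close> has coefficients \<open>n\<close> and
  1.\<close>

definition comb :: "'n::finite config \<Rightarrow> real ^ 'n \<Rightarrow> real \<Rightarrow> real ^ 'n" where
  "comb q c s = (\<Sum>k\<in>UNIV. c $ k *\<^sub>R (fst q $ k)) - s *\<^sub>R snd q"

lemma comb_add: "comb (q + q') c s = comb q c s + comb q' c s"
  and comb_diff: "comb (q - q') c s = comb q c s - comb q' c s"
  and comb_scaleR: "comb (a *\<^sub>R q) c s = a *\<^sub>R comb q c s"
  by (simp_all add: comb_def algebra_simps sum.distrib sum_subtractf scaleR_sum_right)

lemma linear_comb: "linear (\<lambda>q. comb q c s)"
  by (rule linearI) (simp_all add: comb_add comb_scaleR)

lemma bounded_linear_comb: "bounded_linear (\<lambda>q. comb q c s)"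
  using linear_comb linear_conv_bounded_linear by blast

lemma comb_add_vec: "comb q (c + c') (s + s') = comb q c s + comb q c' s'"
  by (simp add: comb_def algebra_simps sum.distrib)

lemma comb_linear_image:
  assumes "linear T"
  shows "comb (\<chi> k. T (fst q $ k), T (snd q)) c s = T (comb q c s)"
  by (simp add: comb_def linear_diff[OF assms] linear_sum[OF assms] linear_cmul[OF assms])

lemma comb_axis: "comb q (axis k a) s = a *\<^sub>R (fst q $ k) - s *\<^sub>R snd q"
  by (simp add: comb_def axis_def if_distrib[of "\<lambda>x. x *\<^sub>R _"] cong: if_cong)

lemma comb_axis_axis:
  "comb q (axis i 1 + axis j 1) 1 = fst q $ i + fst q $ j - snd q"
  using comb_add_vec[of q "axis i 1" "axis j 1" 1 0] by (simp add: comb_axis)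

lemma axis_add_axis: "axis i 1 + axis i 1 = (axis i 2 :: real ^ 'n::finite)"
  by (simp add: vec_eq_iff axis_def)

text \<open>Concerns the removed edges. For a velocity \<open>r\<close> at \<open>r'\<close> this is
  half the rate of change of the squared length; for the difference and the sum of two realizations
  it is the full change. Hence the factors 2 wherever velocities meet
  \<open>long_lengths\<close>.\<close>

definition stretch :: "'n::finite config \<Rightarrow> 'n config \<Rightarrow> 'n \<Rightarrow> real" where
  "stretch r r' i = comb r (axis i 2) 1 \<bullet> comb r' (axis i 2) 1"

text \<open>
  The condition, linear in \<open>r\<close>, that the edges of \<open>F\<^sub>0\<close> keep their length; it is applied both to
  a velocity \<open>r\<close> at the configuration \<open>r'\<close> and to the difference \<open>r\<close> and the sum \<open>r'\<close> of two
  realizations, as $|x|^2 - |y|^2 = (x - y) \cdot (x + y)$.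
\<close>

definition edge_preserving :: "'n::finite config \<Rightarrow> 'n config \<Rightarrow> bool" where
  "edge_preserving r r' \<longleftrightarrow>
     (\<forall>i. comb r (axis i 1) 1 \<bullet> comb r' (axis i 1) 1 = 0) \<and>
     (\<forall>i j. i \<noteq> j \<longrightarrow> comb r (axis i 1 + axis j 1) 1 \<bullet> comb r' (axis i 1 + axis j 1) 1 = 0)"

text \<open>The left side is a symmetric bilinear form in \<open>(c, s)\<close> and
  \<open>(c', s')\<close>, hence determined by its coefficients. For each \<open>i\<close> the edges
  to one and to two periods give two equations, solved by \<open>2 * A i i = S + y i\<close> and
  \<open>b i + b' i = (3 * S + y i) / 2\<close>; the latter is the origin of the constant 3/2. The
  edges to sums of two distinct periods then give \<open>A i j + A j i = S\<close>.\<close>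

lemma gram_variation:
  assumes "edge_preserving r r'"
  shows "comb r c s \<bullet> comb r' c' s' + comb r c' s' \<bullet> comb r' c s =
    (snd r \<bullet> snd r') * (coeff_sum c * coeff_sum c' - 3 / 2 * (s * coeff_sum c' + s' * coeff_sum c) + 2 * s * s') +
    (\<Sum>i\<in>UNIV. stretch r r' i * (c $ i * c' $ i - (s * c' $ i + s' * c $ i) / 2))"
proof -
  define S where "S = snd r \<bullet> snd r'"
  define A where "A i j = fst r $ i \<bullet> fst r' $ j" for i j
  define b where "b i = fst r $ i \<bullet> snd r'" for i
  define b' where "b' i = snd r \<bullet> fst r' $ i" for i
  define y where "y = stretch r r'"
  have e1: "A i i - b i - b' i + S = 0" for i
    using assms unfolding edge_preserving_def
    by (simp add: comb_axis inner_diff_left inner_diff_right A_def b_def b'_def S_def algebra_simps)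
  have y: "y i = 4 * A i i - 2 * b i - 2 * b' i + S" for i
    unfolding y_def stretch_def
    by (simp add: comb_axis inner_diff_left inner_diff_right A_def b_def b'_def S_def algebra_simps)
  have e2: "A i i + A j j + A i j + A j i - b i - b j - b' i - b' j + S = 0" if "i \<noteq> j" for i j
    using assms that unfolding edge_preserving_def
    by (simp add: comb_axis_axis inner_diff_left inner_diff_right inner_add_left inner_add_right
        A_def b_def b'_def S_def algebra_simps)
  have B: "b i + b' i = (3 * S + y i) / 2" for i
    using e1[of i] y[of i] by (simp add: field_simps)
  have AA: "A i j + A j i = S + (if i = j then y i else 0)" for i j
    using e1[of i] e1[of j] y[of i] e2[of i j] by (cases "i = j") auto
  have ip: "comb r c s \<bullet> comb r' c' s' = (\<Sum>i\<in>UNIV. \<Sum>j\<in>UNIV. c $ i * c' $ j * A i j)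
      - (\<Sum>i\<in>UNIV. s' * c $ i * b i) - (\<Sum>i\<in>UNIV. s * c' $ i * b' i) + s * s' * S" for c s c' s'
    by (simp add: comb_def inner_diff_left inner_diff_right inner_sum_left inner_sum_right
        A_def b_def b'_def S_def sum_distrib_left sum_subtractf algebra_simps) (rule sum.swap)
  have "(\<Sum>i\<in>UNIV. \<Sum>j\<in>UNIV. c' $ i * c $ j * A i j) = (\<Sum>i\<in>UNIV. \<Sum>j\<in>UNIV. c $ i * c' $ j * A j i)"
    by (subst sum.swap) (simp add: mult.commute)
  then have "comb r c s \<bullet> comb r' c' s' + comb r c' s' \<bullet> comb r' c s =
      (\<Sum>i\<in>UNIV. \<Sum>j\<in>UNIV. c $ i * c' $ j * (A i j + A j i))
      - (\<Sum>i\<in>UNIV. (s' * c $ i + s * c' $ i) * (b i + b' i)) + 2 * s * s' * S"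
    unfolding ip by (simp add: sum.distrib algebra_simps)
  also have "(\<Sum>i\<in>UNIV. \<Sum>j\<in>UNIV. c $ i * c' $ j * (A i j + A j i))
      = S * coeff_sum c * coeff_sum c' + (\<Sum>i\<in>UNIV. y i * (c $ i * c' $ i))"
  proof -
    have AAc: "c $ i * c' $ j * (A i j + A j i) = S * (c $ i * c' $ j) +
        (if i = j then c $ i * c' $ j * y i else 0)" for i j
      by (simp add: AA algebra_simps)
    have "(\<Sum>i\<in>UNIV. \<Sum>j\<in>UNIV. c $ i * c' $ j * (A i j + A j i))
      = (\<Sum>i\<in>UNIV. \<Sum>j\<in>UNIV. S * (c $ i * c' $ j)) +
        (\<Sum>i\<in>UNIV. \<Sum>j\<in>UNIV. if i = j then c $ i * c' $ j * y i else 0)"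
      by (simp only: AAc sum.distrib)
    also have "\<dots> = S * coeff_sum c * coeff_sum c' + (\<Sum>i\<in>UNIV. y i * (c $ i * c' $ i))"
      by (simp add: coeff_sum_def sum_product sum_distrib_left algebra_simps)
    finally show ?thesis .
  qed
  also have "(\<Sum>i\<in>UNIV. (s' * c $ i + s * c' $ i) * (b i + b' i))
      = 3 / 2 * S * (s * coeff_sum c' + s' * coeff_sum c) + (\<Sum>i\<in>UNIV. y i * ((s * c' $ i + s' * c $ i) / 2))"
    unfolding B by (simp add: coeff_sum_def sum_distrib_left sum.distrib[symmetric] field_simps)
      (intro sum.cong refl, simp add: field_simps)
  finally show ?thesis
    unfolding S_def[symmetric] y_def[symmetric]
    by (simp add: sum_subtractf algebra_simps add_divide_distrib)
qed

lemma gram_variation_diag: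
  assumes "edge_preserving r r'"
  shows "2 * (comb r c s \<bullet> comb r' c s) =
    (snd r \<bullet> snd r') * ((s - coeff_sum c) * (2 * s - coeff_sum c)) +
    (\<Sum>i\<in>UNIV. stretch r r' i * (c $ i * (c $ i - s)))"
proof -
  have N: "N * N - 3 / 2 * (s * N + s * N) + 2 * s * s = (s - N) * (2 * s - N)" for N
    by (simp add: field_simps)
  have c: "x * x - (s * x + s * x) / 2 = x * (x - s)" for x
    by (simp add: field_simps)
  show ?thesis
    using gram_variation[OF assms, of c s c s] unfolding N c by simp
qed

section \<open>Periods as the rows of an invertible matrix\<close>

lemma sum_scaleR_rows: "(\<Sum>k\<in>UNIV. c $ k *\<^sub>R (M $ k)) = transpose M *v c"
  for M :: "real ^ 'n::finite ^ 'n"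
  by (simp only: matrix_mult_sum column_transpose scalar_mult_eq_scaleR row_def vec_lambda_eta)

text \<open>Turns the independence demanded in \<open>realizations\<close> into a polynomial
  condition, which is open and suits Cramer's rule. Injectivity accompanies independence because
  \<open>range\<close> forgets repeated rows.\<close>

lemma rows_independent_iff_det:
  fixes M :: "real ^ 'n::finite ^ 'n"
  shows "inj (\<lambda>k. M $ k) \<and> independent (range (\<lambda>k. M $ k)) \<longleftrightarrow> det M \<noteq> 0"
proof -
  have row: "row i M = M $ i" for i
    by (simp add: row_def vec_eq_iff)
  have "det M \<noteq> 0 \<longleftrightarrow> (\<forall>c. (\<Sum>i\<in>UNIV. c i *\<^sub>R M $ i) = 0 \<longrightarrow> (\<forall>i. c i = 0))"
    by (simp add: invertible_det_nz[symmetric] invertible_right_inverse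
        matrix_right_invertible_independent_rows row scalar_mult_eq_scaleR)
  also have "\<dots> \<longleftrightarrow> inj (\<lambda>k. M $ k) \<and> independent (range (\<lambda>k. M $ k))"
  proof safe
    assume *: "\<forall>c. (\<Sum>i\<in>UNIV. c i *\<^sub>R M $ i) = 0 \<longrightarrow> (\<forall>i. c i = 0)"
    show inj: "inj (\<lambda>k. M $ k)"
    proof (rule injI, rule ccontr)
      fix a b assume ab: "M $ a = M $ b" "a \<noteq> b"
      have "(\<Sum>i\<in>UNIV. ((if i = a then 1 else 0) - (if i = b then 1 else 0)) *\<^sub>R M $ i) = 0"
        using ab by (simp add: scaleR_diff_left sum_subtractf if_distrib[of "\<lambda>x. x *\<^sub>R _"] cong: if_cong)
      then have "(if a = a then 1 else 0) - (if a = b then 1 else 0) = (0::real)"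
        using *[rule_format, of "\<lambda>i. (if i = a then 1 else 0) - (if i = b then 1 else 0)" a] by blast
      then show False
        using ab by simp
    qed
    show "False" if dep: "dependent (range (\<lambda>k. M $ k))"
    proof -
      obtain u v where u: "(\<Sum>v\<in>range (\<lambda>k. M $ k). u v *\<^sub>R v) = 0" "v \<in> range (\<lambda>k. M $ k)" "u v \<noteq> 0"
        using dep by (auto simp: dependent_finite)
      have "(\<Sum>i\<in>UNIV. u (M $ i) *\<^sub>R M $ i) = 0"
        using u(1) by (simp add: sum.reindex[OF inj])
      then show False
        using * u(2,3) by auto
    qed
  next
    fix c i assume inj: "inj (\<lambda>k. M $ k)" and ind: "independent (range (\<lambda>k. M $ k))"
      and 0: "(\<Sum>i\<in>UNIV. c i *\<^sub>R M $ i) = 0"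
    define u where "u v = c (inv (\<lambda>k. M $ k) v)" for v
    have "(\<Sum>v\<in>range (\<lambda>k. M $ k). u v *\<^sub>R v) = 0"
      using 0 by (simp add: sum.reindex[OF inj] u_def inv_f_f[OF inj])
    then have "u (M $ i) = 0"
      using ind by (auto simp: dependent_finite)
    then show "c i = 0"
      by (simp add: u_def inv_f_f[OF inj])
  qed
  finally show ?thesis
    by blast
qed

lemma rows_span:
  fixes M :: "real ^ 'n::finite ^ 'n"
  assumes "det M \<noteq> 0"
  obtains c where "x = (\<Sum>k\<in>UNIV. c $ k *\<^sub>R (M $ k))"
proof -
  have "surj ((*v) (transpose M))"
    unfolding matrix_right_invertible_surjective[symmetric]
    using assms invertible_right_inverse[of "transpose M"] by (simp add: invertible_det_nz)
  then obtain c where "x = transpose M *v c"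
    by (rule surjE)
  then show thesis
    using that by (simp only: sum_scaleR_rows)
qed

lemma orthogonal_to_rows:
  fixes M :: "real ^ 'n::finite ^ 'n"
  assumes "det M \<noteq> 0" "\<And>k. x \<bullet> M $ k = 0"
  shows "x = 0"
proof -
  obtain c where "x = (\<Sum>k\<in>UNIV. c $ k *\<^sub>R (M $ k))"
    using rows_span[OF assms(1)] .
  then have "x \<bullet> x = (\<Sum>k\<in>UNIV. c $ k * (x \<bullet> M $ k))"
    by (metis (no_types, lifting) inner_scaleR_right inner_sum_right sum.cong)
  then show ?thesis
    by (simp add: assms(2))
qed

lemma linear_of_rows:
  fixes M :: "real ^ 'n::finite ^ 'n" and M' :: "'a::real_vector ^ 'n"
  assumes "det M \<noteq> 0"
  obtains T where "linear T" "\<And>k. T (M $ k) = M' $ k"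
proof -
  have M: "inj (\<lambda>k. M $ k)" "independent (range (\<lambda>k. M $ k))"
    using assms rows_independent_iff_det by blast+
  obtain T where "linear T" "\<forall>x\<in>range (\<lambda>k. M $ k). T x = M' $ inv (\<lambda>k. M $ k) x"
    using linear_independent_extend[OF M(2), of "\<lambda>x. M' $ inv (\<lambda>k. M $ k) x"] by blast
  then show thesis
    using that M(1) by (simp add: inv_f_f)
qed

text \<open>The centre lies in the interior of the simplex spanned by the origin and the periods.\<close>

definition centre_inside :: "'n::finite config \<Rightarrow> bool" where
  "centre_inside q \<longleftrightarrow> (\<exists>t. comb q t 1 = 0 \<and> (\<forall>k. 0 < t $ k) \<and> coeff_sum t < 1)"

lemma centre_inside_coefficients:
  assumes "centre_inside q"
  shows "\<exists>t. comb q t 1 = 0 \<and> (\<forall>k. 0 < t $ k \<and> t $ k < 1) \<and> coeff_sum t < 1"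
proof -
  obtain t where t: "comb q t 1 = 0" "\<And>k. 0 < t $ k" "coeff_sum t < 1"
    using assms by (auto simp: centre_inside_def)
  moreover have "t $ k < 1" for k
  proof -
    have "t $ k \<le> coeff_sum t"
      unfolding coeff_sum_def using t(2) by (intro member_le_sum) (auto intro: less_imp_le)
    then show ?thesis
      using t(3) by simp
  qed
  ultimately show ?thesis
    by blast
qed

text \<open>By Cramer's rule the coefficients of the centre in terms of the periods are quotients of
  determinants, hence continuous where the denominator does not vanish.\<close>

lemma open_centre_inside: "open {q :: 'n::finite config. det (fst q) \<noteq> 0 \<and> centre_inside q}"
proof -
  define t where "t q = (\<chi> k. det (\<chi> i j. if j = k then snd q $ i else fst q $ j $ i) / det (fst q))"
    for q :: "'n config"
  have tr: "transpose M $ i $ j = M $ j $ i" for M :: "real ^ 'n ^ 'n" and i j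
    by (simp add: transpose_def)
  have t: "comb q c 1 = 0 \<longleftrightarrow> c = t q" if "det (fst q) \<noteq> 0" for q c
  proof -
    have "det (transpose (fst q)) \<noteq> 0"
      using that by (simp add: det_transpose)
    from cramer[OF this, of c "snd q"] show ?thesis
      by (simp add: comb_def sum_scaleR_rows t_def tr cong: if_cong)
  qed
  have det_cont: "continuous_on UNIV (\<lambda>q :: 'n config. det (fst q))"
    unfolding det_def by (intro continuous_intros)
  then have op: "open {q :: 'n config. det (fst q) \<noteq> 0}"
    by (intro open_Collect_neq) (auto intro: continuous_intros)
  have cont: "continuous_on {q :: 'n config. det (fst q) \<noteq> 0} t"
    unfolding t_def
  proof (intro continuous_intros)
    fix k
    have "continuous_on UNIV (\<lambda>q :: 'n config. (if j = k then snd q $ i else fst q $ j $ i))" for i j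
      by (cases "j = k") (auto intro!: continuous_intros)
    then show "continuous_on {q :: 'n config. det (fst q) \<noteq> 0}
        (\<lambda>q. det (\<chi> i j. if j = k then snd q $ i else fst q $ j $ i))"
      unfolding det_def
      by (intro continuous_intros) (auto intro: continuous_on_subset)
  qed (auto intro: continuous_on_subset[OF det_cont])
  define W where "W = {c :: real ^ 'n. (\<forall>k. 0 < c $ k) \<and> coeff_sum c < 1}"
  have "W = (\<Inter>k. {c. 0 < c $ k}) \<inter> {c. coeff_sum c < 1}"
    by (auto simp: W_def)
  also have "open \<dots>"
    unfolding coeff_sum_def by (intro open_Int open_INT ballI open_Collect_less continuous_intros) auto
  finally have "open ({q. det (fst q) \<noteq> 0} \<inter> t -` W)"
    using continuous_open_preimage[OF cont op] by blast
  moreover have "{q. det (fst q) \<noteq> 0} \<inter> t -` W = {q. det (fst q) \<noteq> 0 \<and> centre_inside q}"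
    by (auto simp: centre_inside_def W_def t)
  ultimately show ?thesis
    by simp
qed

text \<open>\<open>gram_variation\<close> at \<open>t\<close> and \<open>t'\<close>; for centres inside, all coefficients are positive.\<close>

lemma centre_variation:
  assumes "edge_preserving (q' - q) (q' + q)" "comb q t 1 = 0" "comb q' t' 1 = 0"
  shows "(snd (q' - q) \<bullet> snd (q' + q)) *
      ((1 - coeff_sum t) * (1 - coeff_sum t') + ((1 - coeff_sum t) + (1 - coeff_sum t')) / 2) =
    (\<Sum>i\<in>UNIV. stretch (q' - q) (q' + q) i * (t $ i * (1 - t' $ i) + t' $ i * (1 - t $ i)) / 2)"
proof -
  \<comment> \<open>\<open>t\<close> annihilates the Gram form of \<open>q\<close> and
    \<open>t'\<close> that of \<open>q'\<close>: the two products are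
    \<open>comb q' t 1 \<bullet> comb q t' 1\<close> with opposite signs.\<close>
  have "comb (q' - q) t 1 \<bullet> comb (q' + q) t' 1 + comb (q' - q) t' 1 \<bullet> comb (q' + q) t 1 = 0"
    using assms(2,3) by (simp add: comb_add comb_diff inner_commute)
  then have "(snd (q' - q) \<bullet> snd (q' + q)) *
      (coeff_sum t * coeff_sum t' - 3 / 2 * (coeff_sum t' + coeff_sum t) + 2) =
    - (\<Sum>i\<in>UNIV. stretch (q' - q) (q' + q) i * (t $ i * t' $ i - (t' $ i + t $ i) / 2))"
    using gram_variation[OF assms(1), of t 1 t' 1] by simp
  also have "\<dots> = (\<Sum>i\<in>UNIV. stretch (q' - q) (q' + q) i * (t $ i * (1 - t' $ i) + t' $ i * (1 - t $ i)) / 2)"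
    by (subst sum_negf[symmetric]) (intro sum.cong, auto simp: algebra_simps)
  also have "coeff_sum t * coeff_sum t' - 3 / 2 * (coeff_sum t' + coeff_sum t) + 2 =
      (1 - coeff_sum t) * (1 - coeff_sum t') + ((1 - coeff_sum t) + (1 - coeff_sum t')) / 2"
    by (simp add: field_simps)
  finally show ?thesis .
qed

lemma
  assumes "edge_preserving (q' - q) (q' + q)" "centre_inside q" "centre_inside q'"
  shows radius_mono: "(\<And>i. 0 \<le> stretch (q' - q) (q' + q) i) \<Longrightarrow> 0 \<le> snd (q' - q) \<bullet> snd (q' + q)"
    and radius_eq: "(\<And>i. stretch (q' - q) (q' + q) i = 0) \<Longrightarrow> snd (q' - q) \<bullet> snd (q' + q) = 0"
proof -
  obtain t where t: "comb q t 1 = 0" "\<And>k. 0 < t $ k" "\<And>k. t $ k < 1" "coeff_sum t < 1"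
    using centre_inside_coefficients[OF assms(2)] by blast
  obtain t' where t': "comb q' t' 1 = 0" "\<And>k. 0 < t' $ k" "\<And>k. t' $ k < 1" "coeff_sum t' < 1"
    using centre_inside_coefficients[OF assms(3)] by blast
  note eq = centre_variation[OF assms(1) t(1) t'(1)]
  have pos: "0 < (1 - coeff_sum t) * (1 - coeff_sum t') + ((1 - coeff_sum t) + (1 - coeff_sum t')) / 2"
    using t(4) t'(4) by (intro add_pos_pos mult_pos_pos divide_pos_pos) auto
  show "0 \<le> snd (q' - q) \<bullet> snd (q' + q)" if "\<And>i. 0 \<le> stretch (q' - q) (q' + q) i"
  proof -
    have "0 \<le> (\<Sum>i\<in>UNIV. stretch (q' - q) (q' + q) i * (t $ i * (1 - t' $ i) + t' $ i * (1 - t $ i)) / 2)"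
      using that t t' by (intro sum_nonneg divide_nonneg_nonneg mult_nonneg_nonneg add_nonneg_nonneg)
        (auto intro: less_imp_le)
    then show ?thesis
      unfolding eq[symmetric] using pos by (simp add: zero_le_mult_iff)
  qed
  show "snd (q' - q) \<bullet> snd (q' + q) = 0" if "\<And>i. stretch (q' - q) (q' + q) i = 0"
    using eq that pos by simp
qed

section \<open>Distances in two realizations compared\<close>

lemma stretch_diff_sum:
  "stretch (q' - q) (q' + q) i = (norm (comb q' (axis i 2) 1))\<^sup>2 - (norm (comb q (axis i 2) 1))\<^sup>2"
  by (simp add: stretch_def comb_add comb_diff power2_norm_eq_inner algebra_simps inner_commute)

lemma edge_preserving_diff_sum:
  "edge_preserving (q' - q) (q' + q) \<longleftrightarrow>
     (\<forall>i. norm (comb q' (axis i 1) 1) = norm (comb q (axis i 1) 1)) \<and>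
     (\<forall>i j. i \<noteq> j \<longrightarrow> norm (comb q' (axis i 1 + axis j 1) 1) = norm (comb q (axis i 1 + axis j 1) 1))"
proof -
  have "comb (q' - q) c s \<bullet> comb (q' + q) c s = 0 \<longleftrightarrow> norm (comb q' c s) = norm (comb q c s)" for c s
    by (simp add: comb_add comb_diff norm_eq algebra_simps inner_commute)
  then show ?thesis
    by (simp add: edge_preserving_def)
qed

lemma norm_comb_diff_sum:
  assumes "edge_preserving (q' - q) (q' + q)"
  shows "2 * ((norm (comb q' c s))\<^sup>2 - (norm (comb q c s))\<^sup>2) =
    (snd (q' - q) \<bullet> snd (q' + q)) * ((s - coeff_sum c) * (2 * s - coeff_sum c)) +
    (\<Sum>i\<in>UNIV. stretch (q' - q) (q' + q) i * (c $ i * (c $ i - s)))"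
  unfolding gram_variation_diag[OF assms, symmetric]
  by (simp add: comb_add comb_diff power2_norm_eq_inner algebra_simps inner_commute)

text \<open>For \<open>s = 1\<close> the factors are consecutive integers, which never have opposite
  signs; for \<open>s = 0\<close> the product is a square.\<close>

lemma of_int_mult_diff_nonneg:
  fixes m :: int and s :: real
  assumes "s = 0 \<or> s = 1"
  shows "0 \<le> real_of_int m * (real_of_int m - s)" "0 \<le> real_of_int m * (real_of_int m + s)"
proof -
  have "0 \<le> m * m" "0 \<le> m * (m - 1)" "0 \<le> m * (m + 1)"
    by (auto simp: zero_le_mult_iff)
  then have "0 \<le> real_of_int (m * m)" "0 \<le> real_of_int (m * (m - 1))" "0 \<le> real_of_int (m * (m + 1))"
    by (simp_all only: of_int_0_le_iff)
  then show "0 \<le> real_of_int m * (real_of_int m - s)" "0 \<le> real_of_int m * (real_of_int m + s)"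
    using assms by auto
qed

text \<open>Both products are covered by \<open>of_int_mult_diff_nonneg\<close>: with
  \<open>m = s - N\<close>, where \<open>N\<close> is the coefficient sum, the first one is
  \<open>m * (m + s)\<close>.\<close>

lemma integral_coefficients_nonneg:
  assumes "s = 0 \<or> s = 1"
  shows "0 \<le> (s - coeff_sum (of_int_vec n)) * (2 * s - coeff_sum (of_int_vec n))"
    and "0 \<le> of_int_vec n $ i * (of_int_vec n $ i - s)"
proof -
  define m where "m = (if s = 0 then 0 else 1) - (\<Sum>k\<in>UNIV. n $ k)"
  have m: "s - coeff_sum (of_int_vec n) = real_of_int m"
    using assms by (auto simp: coeff_sum_def of_int_vec_def m_def)
  have "2 * s - coeff_sum (of_int_vec n) = real_of_int m + s"
    unfolding m[symmetric] by simp
  then show "0 \<le> (s - coeff_sum (of_int_vec n)) * (2 * s - coeff_sum (of_int_vec n))"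
    unfolding m using of_int_mult_diff_nonneg(2)[OF assms] by metis
  show "0 \<le> of_int_vec n $ i * (of_int_vec n $ i - s)"
    using of_int_mult_diff_nonneg(1)[OF assms] by (simp add: of_int_vec_def)
qed

text \<open>\<open>n\<close> and \<open>s\<close> depend on the two joints alone and serve all
  configurations at once. As the norm ignores the sign of the difference vector, the joints can be
  ordered so that \<open>s\<close> is 1 and never -1.\<close>

lemma dist_placement:
  "\<exists>n s. (s = 0 \<or> s = 1) \<and>
    (\<forall>q. dist (placement q a) (placement q b) = norm (comb q (of_int_vec n) s))"
proof -
  have *: "(\<Sum>k\<in>UNIV. (real_of_int ((m - n) $ k)) *\<^sub>R x k) =
      (\<Sum>k\<in>UNIV. real_of_int (m $ k) *\<^sub>R x k) - (\<Sum>k\<in>UNIV. real_of_int (n $ k) *\<^sub>R x k)"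
    for m n :: "int ^ 'n" and x :: "'n \<Rightarrow> real ^ 'n"
    by (simp add: algebra_simps sum_subtractf)
  show ?thesis
  proof (cases a; cases b)
    fix m n assume "a = Lattice m" "b = Lattice n"
    then show ?thesis
      by (intro exI[of _ "m - n"] exI[of _ 0]) (simp_all add: comb_def of_int_vec_def * dist_norm del: vector_minus_component)
  next
    fix m n assume "a = Centre m" "b = Centre n"
    then show ?thesis
      by (intro exI[of _ "m - n"] exI[of _ 0]) (simp_all add: comb_def of_int_vec_def * dist_norm del: vector_minus_component)
  next
    fix m n assume "a = Lattice m" "b = Centre n"
    then show ?thesis
      by (intro exI[of _ "m - n"] exI[of _ 1]) (simp_all add: comb_def of_int_vec_def * dist_norm algebra_simps del: vector_minus_component)
  next
    fix m n assume "a = Centre m" "b = Lattice n"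
    then show ?thesis
      by (intro exI[of _ "n - m"] exI[of _ 1])
        (simp_all add: comb_def of_int_vec_def * dist_norm norm_minus_commute algebra_simps
          del: vector_minus_component)
  qed
qed

lemma dist_placement_Centre_Lattice:
  "dist (placement q (Centre m)) (placement q (Lattice (m + n))) = norm (comb q (of_int_vec n) 1)"
  by (subst dist_commute) (simp add: comb_def of_int_vec_def dist_norm algebra_simps sum.distrib)

lemma dist_placement_mono:
  assumes "edge_preserving (q' - q) (q' + q)" "centre_inside q" "centre_inside q'"
    "\<And>i. 0 \<le> stretch (q' - q) (q' + q) i"
  shows "dist (placement q a) (placement q b) \<le> dist (placement q' a) (placement q' b)"
proof -
  obtain n s where s: "s = 0 \<or> s = 1"
    and d: "\<And>q. dist (placement q a) (placement q b) = norm (comb q (of_int_vec n) s)"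
    using dist_placement[of a b] by blast
  have "0 \<le> 2 * ((norm (comb q' (of_int_vec n) s))\<^sup>2 - (norm (comb q (of_int_vec n) s))\<^sup>2)"
    unfolding norm_comb_diff_sum[OF assms(1)]
    by (intro add_nonneg_nonneg sum_nonneg mult_nonneg_nonneg[OF radius_mono[OF assms]]
        mult_nonneg_nonneg[OF assms(4)] integral_coefficients_nonneg[OF s])
  then show ?thesis
    unfolding d by (auto intro: power2_le_imp_le[OF _ norm_ge_zero])
qed

text \<open>If no removed edge changes its length, neither does the vector from the origin to the
  centre, and the whole Gram form is preserved. Arbitrary real coefficients are what
  \<open>congruent_iff_norm_comb\<close> asks for.\<close>

lemma norm_comb_eq:
  assumes "edge_preserving (q' - q) (q' + q)" "centre_inside q" "centre_inside q'"
    "\<And>i. stretch (q' - q) (q' + q) i = 0"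
  shows "norm (comb q' c s) = norm (comb q c s)"
proof -
  have "2 * ((norm (comb q' c s))\<^sup>2 - (norm (comb q c s))\<^sup>2) = 0"
    unfolding norm_comb_diff_sum[OF assms(1)] using radius_eq[OF assms] assms(4) by simp
  then show ?thesis
    by simp
qed

section \<open>Charts of the deformation space\<close>

lemma fst_eq_comb: "fst q $ k = comb q (axis k 1) 0"
  and snd_eq_comb: "snd q = comb q 0 (- 1)"
  by (simp_all add: comb_axis) (simp add: comb_def)

lemma placement_eq_comb:
  "placement q (Lattice n) = comb q (of_int_vec n) 0"
  "placement q (Centre n) = comb q (of_int_vec n) (- 1)"
  by (simp_all add: comb_def of_int_vec_def)

text \<open>An isometry relating the placements fixes the origin, where \<open>Lattice 0\<close> is
  placed, and is therefore orthogonal. Conversely the linear map carrying the periods of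
  \<open>q\<close> to those of \<open>q'\<close> preserves norms, and it carries the centre along:
  the relation \<open>comb q t 1 = 0\<close> says that a norm vanishes, hence it persists in
  \<open>q'\<close>.\<close>

lemma congruent_iff_norm_comb:
  fixes q q' :: "'n::finite config"
  assumes "det (fst q) \<noteq> 0"
  shows "congruent q q' \<longleftrightarrow> (\<forall>c s. norm (comb q' c s) = norm (comb q c s))"
proof
  assume "congruent q q'"
  then obtain T where T: "\<And>x y. dist (T x) (T y) = dist x y" "\<And>a. placement q' a = T (placement q a)"
    unfolding congruent_def by blast
  have "T 0 = 0"
    using T(2)[of "Lattice 0"] by simp
  then have orth: "orthogonal_transformation T"
    using T(1) orthogonal_transformation_isometry by blast
  then have lin: "linear T"
    by (rule orthogonal_transformation_linear)
  have "of_int_vec (axis k 1) = axis k 1" "of_int_vec 0 = (0 :: real ^ 'n)" for k :: 'n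
    by (simp_all add: of_int_vec_def axis_def vec_eq_iff)
  then have "fst q' $ k = T (fst q $ k)" "snd q' = T (snd q)" for k
    using T(2)[of "Lattice (axis k 1)"] T(2)[of "Centre 0"]
    unfolding placement_eq_comb by (simp_all add: fst_eq_comb snd_eq_comb)
  then have "q' = (\<chi> k. T (fst q $ k), T (snd q))"
    by (simp add: prod_eq_iff vec_eq_iff[where x = "fst q'"])
  then have "comb q' c s = T (comb q c s)" for c s
    by (simp add: comb_linear_image[OF lin])
  then show "\<forall>c s. norm (comb q' c s) = norm (comb q c s)"
    using orth by (simp add: orthogonal_transformation_norm)
next
  assume *: "\<forall>c s. norm (comb q' c s) = norm (comb q c s)"
  obtain T where T: "linear T" and row: "\<forall>k. T (fst q $ k) = fst q' $ k"
    using linear_of_rows[OF assms, of "fst q'"] by metis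
  have T0: "T (comb q c 0) = comb q' c 0" for c
    by (simp add: comb_def linear_sum[OF T] linear_cmul[OF T] row)
  obtain t where "snd q = (\<Sum>k\<in>UNIV. t $ k *\<^sub>R (fst q $ k))"
    by (rule rows_span[OF assms])
  then have t: "comb q t 1 = 0" "snd q = comb q t 0"
    by (simp_all add: comb_def)
  then have "comb q' t 1 = 0"
    using * by (metis norm_eq_zero)
  then have "T (snd q) = snd q'"
    unfolding t(2) T0 by (simp add: comb_def)
  then have q': "q' = (\<chi> k. T (fst q $ k), T (snd q))"
    by (simp add: prod_eq_iff vec_eq_iff[where x = "fst q'"] row)
  have img: "comb q' c s = T (comb q c s)" for c s
    by (subst q') (rule comb_linear_image[OF T])
  have "norm (T x) = norm x" for x
  proof -
    obtain c where "x = (\<Sum>k\<in>UNIV. c $ k *\<^sub>R (fst q $ k))"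
      by (rule rows_span[OF assms])
    then have "x = comb q c 0"
      by (simp add: comb_def)
    then show ?thesis
      using * T0 by metis
  qed
  then have "dist (T x) (T y) = dist x y" for x y
    by (metis T dist_norm linear_diff)
  moreover have "placement q' a = T (placement q a)" for a
    by (cases a) (simp_all add: placement_eq_comb img del: placement.simps)
  ultimately show "congruent q q'"
    unfolding congruent_def by blast
qed

lemma realizations_det: "q \<in> realizations E p \<Longrightarrow> det (fst q) \<noteq> 0"
  using rows_independent_iff_det[of "fst q"] by (simp add: realizations_def)

lemma congruence_class_eq_iff:
  assumes "q \<in> realizations E p" "q' \<in> realizations E p"
  shows "congruence_class E p q = congruence_class E p q' \<longleftrightarrow> congruent q q'"
proof
  show "congruent q q'" if "congruence_class E p q = congruence_class E p q'"
  proof -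
    have "q' \<in> congruence_class E p q'"
      using assms by (simp add: congruence_class_def congruent_iff_norm_comb[OF realizations_det])
    then show ?thesis
      unfolding that[symmetric] by (simp add: congruence_class_def)
  qed
  show "congruence_class E p q = congruence_class E p q'" if "congruent q q'"
    using that assms
    by (auto simp: congruence_class_def congruent_iff_norm_comb[OF realizations_det])
qed

lemma centre_inside_congruent:
  assumes "det (fst q) \<noteq> 0" "congruent q q'" "centre_inside q"
  shows "centre_inside q'"
proof -
  have "comb q' c s = 0 \<longleftrightarrow> comb q c s = 0" for c s
    using assms(2) unfolding congruent_iff_norm_comb[OF assms(1)] by (metis norm_eq_zero)
  then show ?thesis
    using assms(3) by (simp add: centre_inside_def)
qed

lemma topspace_configuration_space:
  "topspace (configuration_space E p) = congruence_class E p ` realizations E p"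
proof
  have "{q \<in> realizations E p. congruence_class E p q \<in> congruence_class E p ` realizations E p} = realizations E p"
    by blast
  then have "openin (configuration_space E p) (congruence_class E p ` realizations E p)"
    by (simp add: openin_configuration_space)
  then show "congruence_class E p ` realizations E p \<subseteq> topspace (configuration_space E p)"
    by (rule openin_subset)
  show "topspace (configuration_space E p) \<subseteq> congruence_class E p ` realizations E p"
    using openin_topspace[of "configuration_space E p"] unfolding openin_configuration_space by blast
qed

text \<open>
  A chart of the deformation space: coordinates \<open>J\<close> that separate congruence classes on an
  open set \<open>N\<close> of realizations, with a section \<open>\<phi>\<close>.
\<close>

lemma local_parametrizationI:
  fixes \<phi> :: "'k::euclidean_space \<Rightarrow> 'n::finite config" and J :: "'n config \<Rightarrow> 'k"
    and E :: "'n edges" and p :: "'n config"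
  defines "R \<equiv> realizations E p"
  assumes U: "open U" "connected U" "0 \<in> U" and \<phi>: "\<phi> 0 = p" "smooth_on \<phi> U" "\<phi> ` U \<subseteq> N"
    and N: "openin (top_of_set R) N"
      "\<And>q q'. q \<in> N \<Longrightarrow> q' \<in> R \<Longrightarrow> congruent q q' \<Longrightarrow> q' \<in> N"
    and J: "\<And>q. (J has_derivative J' q) (at q)"
      "\<And>q q'. q \<in> R \<Longrightarrow> q' \<in> R \<Longrightarrow> congruent q q' \<Longrightarrow> J q = J q'"
      "\<And>q q'. q \<in> N \<Longrightarrow> q' \<in> N \<Longrightarrow> J q = J q' \<Longrightarrow> congruent q q'"
      "\<And>u. u \<in> U \<Longrightarrow> J (\<phi> u) = u"
      "\<And>q w. w \<in> infinitesimal_rotations q \<Longrightarrow> J' q w = 0"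
  shows "local_parametrization E p U \<phi>"
proof -
  let ?class = "congruence_class E p" and ?X = "configuration_space E p"
  let ?f = "\<lambda>u. ?class (\<phi> u)"
  have NR: "N \<subseteq> R"
    using N(1) by (rule openin_imp_subset)
  have \<phi>R: "\<phi> ` U \<subseteq> R"
    using \<phi>(3) NR by blast
  have class_eq: "?class q = ?class q' \<longleftrightarrow> congruent q q'" if "q \<in> R" "q' \<in> R" for q q'
    using that unfolding R_def by (rule congruence_class_eq_iff)
  have cont_\<phi>: "continuous_on U \<phi>"
    using \<phi>(2) by (rule smooth_on_imp_continuous_on)
  have cont: "continuous_map (top_of_set U) ?X ?f"
    unfolding continuous_map_def
  proof (intro conjI allI impI)
    show "?f \<in> topspace (top_of_set U) \<rightarrow> topspace ?X"
      using \<phi>R by (auto simp: topspace_configuration_space R_def)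
    fix S assume "openin ?X S"
    then have S: "openin (top_of_set R) {q \<in> R. ?class q \<in> S}"
      by (simp add: openin_configuration_space R_def)
    have "{u \<in> topspace (top_of_set U). ?f u \<in> S} = U \<inter> \<phi> -` {q \<in> R. ?class q \<in> S}"
      using \<phi>R by auto
    also have "openin (top_of_set U) \<dots>"
      using continuous_openin_preimage[OF cont_\<phi> _ S] \<phi>R by blast
    finally show "openin (top_of_set U) {u \<in> topspace (top_of_set U). ?f u \<in> S}" .
  qed
  have cls0: "?class p = ?f 0"
    by (simp add: \<phi>(1))
  have "connectedin ?X (?f ` U)"
    using connectedin_continuous_map_image[OF cont, of U] U(2)
    by (simp add: connectedin_subtopology)
  then have comp: "?f ` U \<subseteq> connected_component_of_set ?X (?class p)"
    unfolding cls0 using U(3) by (intro connected_component_of_maximal) auto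
  have open_img: "openin (deformation_space E p) (?f ` W)" if W: "openin (top_of_set U) W" for W
  proof -
    have WU: "W \<subseteq> U" and "open W"
      using W U(1) openin_open_eq by blast+
    \<comment> \<open>Openness in the quotient means openness of the preimage in \<open>R\<close>.
      As \<open>J\<close> is constant on classes and separates those in the saturated set
      \<open>N\<close>, this preimage is cut out of \<open>N\<close> by the condition that
      \<open>J\<close> takes values in \<open>W\<close>.\<close>
    have "{q \<in> R. ?class q \<in> ?f ` W} = N \<inter> (R \<inter> J -` W)"
    proof (intro subset_antisym subsetI)
      fix q assume "q \<in> {q \<in> R. ?class q \<in> ?f ` W}"
      then obtain u where u: "q \<in> R" "u \<in> W" "?class (\<phi> u) = ?class q"
        by auto
      then have "\<phi> u \<in> N" "\<phi> u \<in> R" "u \<in> U"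
        using u(2) \<phi>(3) \<phi>R WU by blast+
      then have "congruent (\<phi> u) q"
        using u class_eq by blast
      then have "q \<in> N" "J q = u"
        using N(2)[OF \<open>\<phi> u \<in> N\<close> u(1)] J(2)[OF \<open>\<phi> u \<in> R\<close> u(1)] J(4)[OF \<open>u \<in> U\<close>] by auto
      then show "q \<in> N \<inter> (R \<inter> J -` W)"
        using u by auto
    next
      fix q assume q: "q \<in> N \<inter> (R \<inter> J -` W)"
      then have u: "J q \<in> U" "J q \<in> W"
        using WU by auto
      then have "\<phi> (J q) \<in> N" "J (\<phi> (J q)) = J q"
        using \<phi>(3) J(4) by auto
      then have "congruent (\<phi> (J q)) q"
        using J(3) q by auto
      then have "?class q = ?f (J q)"
        using class_eq[of "\<phi> (J q)" q] q \<open>\<phi> (J q) \<in> N\<close> NR by auto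
      then show "q \<in> {q \<in> R. ?class q \<in> ?f ` W}"
        using q u(2) by blast
    qed
    moreover have "openin (top_of_set R) (R \<inter> J -` W)"
    proof -
      have "continuous_on R J"
        using J(1) has_derivative_continuous by (intro continuous_at_imp_continuous_on) blast
      then show ?thesis
        using \<open>open W\<close> by (rule continuous_openin_preimage_gen)
    qed
    ultimately have "openin (top_of_set R) {q \<in> R. ?class q \<in> ?f ` W}"
      using N(1) by (simp add: openin_Int)
    then have "openin ?X (?f ` W)"
      unfolding openin_configuration_space using WU \<phi>R by (auto simp: R_def)
    moreover have "?f ` W \<subseteq> connected_component_of_set ?X (?class p)"
      using comp WU by blast
    ultimately show ?thesis
      unfolding deformation_space_def openin_subtopology by blast
  qed
  have "embedding_map (top_of_set U) (deformation_space E p) ?f"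
  proof (rule injective_open_imp_embedding_map)
    show "continuous_map (top_of_set U) (deformation_space E p) ?f"
      unfolding deformation_space_def using cont comp by (simp add: continuous_map_in_subtopology image_subset_iff_funcset)
    show "open_map (top_of_set U) (deformation_space E p) ?f"
      unfolding open_map_def using open_img by blast
    show "inj_on ?f (topspace (top_of_set U))"
    proof (rule inj_onI)
      fix u u' assume u: "u \<in> topspace (top_of_set U)" "u' \<in> topspace (top_of_set U)" "?f u = ?f u'"
      then have "\<phi> u \<in> R" "\<phi> u' \<in> R"
        using \<phi>R by auto
      then have "J (\<phi> u) = J (\<phi> u')"
        using u(3) class_eq J(2) by blast
      then show "u = u'"
        using u J(4) by simp
    qed
  qed
  \<comment> \<open>Differentiating \<open>J (\<phi> u) = u\<close> makes \<open>J'\<close> a left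
    inverse of the derivative of \<open>\<phi>\<close>. Since \<open>J'\<close> kills infinitesimal
    rotations, only \<open>h = 0\<close> can be mapped to one.\<close>
  moreover have "h = 0" if u: "u \<in> U" and h: "frechet_derivative \<phi> (at u) h \<in> infinitesimal_rotations (\<phi> u)"
    for u h
  proof -
    have "((\<lambda>u. J (\<phi> u)) has_derivative (\<lambda>h. J' (\<phi> u) (frechet_derivative \<phi> (at u) h))) (at u)"
      by (rule has_derivative_compose[OF smooth_on_imp_has_derivative[OF \<phi>(2) u] J(1)])
    moreover have "((\<lambda>u. J (\<phi> u)) has_derivative (\<lambda>h. h)) (at u)"
      by (rule has_derivative_transform_within_open[OF has_derivative_ident U(1) u]) (simp add: J(4))
    ultimately have "J' (\<phi> u) (frechet_derivative \<phi> (at u) h) = h"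
      using has_derivative_unique by metis
    then show ?thesis
      using J(5)[OF h] by simp
  qed
  moreover have "openin (deformation_space E p) (?f ` U)"
    by (rule open_img) simp
  ultimately show ?thesis
    unfolding local_parametrization_def using U \<phi> \<phi>R R_def by blast
qed

section \<open>Infinitesimal rotations and first-order variations\<close>

lemma comb_infinitesimal_rotation:
  assumes "w \<in> infinitesimal_rotations q"
  shows "comb w c s \<bullet> comb q c s = 0"
proof -
  obtain A where A: "linear A" "\<And>x y. A x \<bullet> y = - (x \<bullet> A y)"
    and w: "w = (\<chi> k. A (fst q $ k), A (snd q))"
    using assms by (auto simp: infinitesimal_rotations_def)
  have "A x \<bullet> x = 0" for x
    using A(2)[of x x] by (simp add: inner_commute)
  then show ?thesis
    by (simp add: w comb_linear_image[OF A(1)])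
qed

text \<open>Infinitesimal counterpart of \<open>congruent_iff_norm_comb\<close>. The velocities of
  the periods define a linear map, which is skew by the hypothesis for \<open>s = s' = 0\<close>;
  the velocity of the centre is then forced by its inner products with the periods.\<close>

lemma infinitesimal_rotationI:
  assumes "det (fst q) \<noteq> 0"
    and skew: "\<And>c s c' s'. comb w c s \<bullet> comb q c' s' + comb w c' s' \<bullet> comb q c s = 0"
  shows "w \<in> infinitesimal_rotations q"
proof -
  obtain A where A: "linear A" and row: "\<forall>k. A (fst q $ k) = fst w $ k"
    using linear_of_rows[OF assms(1), of "fst w"] by metis
  have A0: "A (comb q c 0) = comb w c 0" for c
    by (simp add: comb_def linear_sum[OF A] linear_cmul[OF A] row)
  have span: "\<exists>c. x = comb q c 0" for x
    using rows_span[OF assms(1), of x] by (metis comb_def diff_zero scaleR_zero_left)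
  have A_skew: "A x \<bullet> y = - (x \<bullet> A y)" for x y
    using span[of x] span[of y] skew[of _ 0 _ 0] A0 by (metis add_eq_0_iff inner_commute)
  have "A (snd q) - snd w = 0"
  proof (rule orthogonal_to_rows[OF assms(1)])
    fix k
    have "A (snd q) \<bullet> fst q $ k = - (snd q \<bullet> fst w $ k)"
      by (simp add: A_skew row)
    moreover have "snd w \<bullet> fst q $ k = - (snd q \<bullet> fst w $ k)"
      using skew[of "axis k 1" 0 0 "-1"] by (simp add: fst_eq_comb snd_eq_comb inner_commute)
    ultimately show "(A (snd q) - snd w) \<bullet> fst q $ k = 0"
      by (simp add: inner_diff_left)
  qed
  then have "w = (\<chi> k. A (fst q $ k), A (snd q))"
    by (simp add: prod_eq_iff vec_eq_iff[where x = "fst w"] row)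
  then show ?thesis
    using A A_skew unfolding infinitesimal_rotations_def by blast
qed

text \<open>Infinitesimal counterpart of \<open>centre_variation\<close>. Here the single relation
  \<open>t\<close> of \<open>p\<close> suffices, because \<open>comb p t 1\<close> is a factor of
  the left side of \<open>gram_variation_diag\<close>.\<close>

lemma radius_velocity:
  assumes "edge_preserving w p" "comb p t 1 = 0"
  shows "(snd w \<bullet> snd p) * ((1 - coeff_sum t) * (2 - coeff_sum t)) =
    (\<Sum>i\<in>UNIV. stretch w p i * (t $ i * (1 - t $ i)))"
proof -
  have "(snd w \<bullet> snd p) * ((1 - coeff_sum t) * (2 - coeff_sum t)) =
      - (\<Sum>i\<in>UNIV. stretch w p i * (t $ i * (t $ i - 1)))"
    using gram_variation_diag[OF assms(1), of t 1] assms(2) by simp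
  also have "\<dots> = (\<Sum>i\<in>UNIV. stretch w p i * (t $ i * (1 - t $ i)))"
    by (subst sum_negf[symmetric]) (intro sum.cong, auto simp: algebra_simps)
  finally show ?thesis .
qed

lemma
  assumes "edge_preserving w p" "centre_inside p"
  shows radius_velocity_nonneg: "(\<And>i. 0 \<le> stretch w p i) \<Longrightarrow> 0 \<le> snd w \<bullet> snd p"
    and radius_velocity_eq_0: "(\<And>i. stretch w p i = 0) \<Longrightarrow> snd w \<bullet> snd p = 0"
proof -
  obtain t where t: "comb p t 1 = 0" "\<And>k. 0 < t $ k" "\<And>k. t $ k < 1" "coeff_sum t < 1"
    using centre_inside_coefficients[OF assms(2)] by blast
  note eq = radius_velocity[OF assms(1) t(1)]
  have pos: "0 < (1 - coeff_sum t) * (2 - coeff_sum t)"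
    using t(4) by simp
  show "0 \<le> snd w \<bullet> snd p" if "\<And>i. 0 \<le> stretch w p i"
  proof -
    have "0 \<le> (\<Sum>i\<in>UNIV. stretch w p i * (t $ i * (1 - t $ i)))"
      using that t by (intro sum_nonneg mult_nonneg_nonneg) (auto intro: less_imp_le)
    then show ?thesis
      unfolding eq[symmetric] using mult_neg_pos[OF _ pos] by (meson not_le)
  qed
  show "snd w \<bullet> snd p = 0" if "\<And>i. stretch w p i = 0"
    using eq that less_imp_neq[OF pos] by simp
qed

lemma unstretched_imp_infinitesimal_rotation:
  assumes "det (fst p) \<noteq> 0" "centre_inside p" "edge_preserving w p" "\<And>i. stretch w p i = 0"
  shows "w \<in> infinitesimal_rotations p"
  using assms(1)
proof (rule infinitesimal_rotationI)
  show "comb w c s \<bullet> comb p c' s' + comb w c' s' \<bullet> comb p c s = 0" for c s c' s'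
    unfolding gram_variation[OF assms(3)]
    using assms(4) radius_velocity_eq_0[OF assms(3,2,4)] by simp
qed

section \<open>Edge orbits of the frameworks and their realizations\<close>

lemma of_int_vec_add: "of_int_vec (m + n) = of_int_vec m + of_int_vec n"
  by (simp add: of_int_vec_def vec_eq_iff)

lemma of_int_vec_axis: "of_int_vec (axis i a) = axis i (of_int a)"
  by (simp add: of_int_vec_def vec_eq_iff axis_def)

lemma centre_edge_orbit_eq: "centre_edge_orbit n = range (\<lambda>m. (Centre m, Lattice (m + n)))"
  by (simp add: centre_edge_orbit_def edge_orbit_def)

text \<open>An edge from \<open>Centre m\<close> to \<open>Lattice (m + n)\<close> determines
  \<open>n\<close>, so distinct orbits are disjoint and removing orbits amounts to removing
  indices.\<close>

lemma centre_edge_orbits_diff: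
  fixes S S' :: "(int ^ 'n::finite) set"
  shows "(\<Union>n\<in>S. centre_edge_orbit n) - (\<Union>n\<in>S'. centre_edge_orbit n) = (\<Union>n\<in>S - S'. centre_edge_orbit n)"
proof -
  have uniq: "m = n" if "x \<in> centre_edge_orbit m" "x \<in> centre_edge_orbit n" for x and m n :: "int ^ 'n"
    using that by (auto simp: centre_edge_orbit_eq)
  have "n \<notin> S'" if "n \<in> S" "x \<in> centre_edge_orbit n" "x \<notin> (\<Union>n\<in>S'. centre_edge_orbit n)" for n x
    using that by blast
  moreover have "x \<notin> (\<Union>n\<in>S'. centre_edge_orbit n)" if "n \<in> S - S'" "x \<in> centre_edge_orbit n" for n x
    using that uniq[of x n] by blast
  ultimately show ?thesis
    by blast
qed

lemma realizations_centre_edge_orbits: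
  "q \<in> realizations (\<Union>n\<in>S. centre_edge_orbit n) p \<longleftrightarrow>
    det (fst q) \<noteq> 0 \<and> (\<forall>n\<in>S. norm (comb q (of_int_vec n) 1) = norm (comb p (of_int_vec n) 1))"
proof -
  have "(\<forall>(a, b)\<in>(\<Union>n\<in>S. centre_edge_orbit n).
        dist (placement q a) (placement q b) = dist (placement p a) (placement p b)) \<longleftrightarrow>
    (\<forall>n\<in>S. \<forall>m. dist (placement q (Centre m)) (placement q (Lattice (m + n)))
        = dist (placement p (Centre m)) (placement p (Lattice (m + n))))"
    by (simp add: centre_edge_orbit_eq del: placement.simps)
  then show ?thesis
    unfolding realizations_def mem_Collect_eq rows_independent_iff_det[symmetric]
      dist_placement_Centre_Lattice by blast
qed

definition short_edges :: "(int ^ 'n::finite) set" where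
  "short_edges = range (\<lambda>i. axis i 1) \<union> (\<lambda>(i, j). axis i 1 + axis j 1) ` {(i, j). i \<noteq> j}"

lemma ball_short_edges:
  "(\<forall>n\<in>short_edges. P n) \<longleftrightarrow>
    (\<forall>i. P (axis i 1)) \<and> (\<forall>i j. i \<noteq> j \<longrightarrow> P (axis i 1 + axis j 1))"
  by (simp add: short_edges_def ball_Un)

lemma axis_2_notin_short_edges: "axis i 2 \<notin> (short_edges :: (int ^ 'n::finite) set)"
proof
  assume "axis i 2 \<in> (short_edges :: (int ^ 'n) set)"
  then have "(\<exists>j. axis i 2 = (axis j 1 :: int ^ 'n)) \<or> (\<exists>j k. j \<noteq> k \<and> axis i 2 = (axis j 1 + axis k 1 :: int ^ 'n))"
    by (auto simp: short_edges_def)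
  then show False
  proof (elim disjE exE conjE)
    fix j assume "axis i 2 = (axis j 1 :: int ^ 'n)"
    from arg_cong[OF this, of "\<lambda>x. x $ i"] show False
      by (simp add: axis_def split: if_splits)
  next
    fix j k assume jk: "j \<noteq> k" and "axis i 2 = (axis j 1 + axis k 1 :: int ^ 'n)"
    from arg_cong[OF this(2), of "\<lambda>x. x $ i"] show False
      using jk by (auto simp: axis_def split: if_splits)
  qed
qed

lemma edges_F_eq:
  "(edges_F :: 'n::finite edges) = (\<Union>n\<in>short_edges \<union> range (\<lambda>i. axis i 2). centre_edge_orbit n)"
  by (simp add: edges_F_def short_edges_def case_prod_beta Un_ac)

lemma edges_F0_eq: "(edges_F0 :: 'n::finite edges) = (\<Union>n\<in>short_edges. centre_edge_orbit n)"
proof -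
  have "short_edges \<union> range (\<lambda>i. axis i 2) - range (\<lambda>i. axis i 2) = (short_edges :: (int ^ 'n) set)"
    using axis_2_notin_short_edges by auto
  moreover have "(\<Union>i. centre_edge_orbit (axis i 2)) = (\<Union>n\<in>range (\<lambda>i. axis i 2). centre_edge_orbit (n :: int ^ 'n))"
    by simp
  ultimately show ?thesis
    unfolding edges_F0_def edges_F_eq by (simp only: centre_edge_orbits_diff)
qed

lemma edges_F_without_eq:
  "edges_F_without i = (\<Union>n\<in>short_edges \<union> (\<lambda>j. axis j 2) ` (- {i}). centre_edge_orbit n)"
proof -
  have "short_edges \<union> range (\<lambda>i. axis i 2) - {axis i 2} = short_edges \<union> (\<lambda>j. axis j 2) ` (- {i})"
    using axis_2_notin_short_edges by (auto simp: axis_eq_axis)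
  moreover have "centre_edge_orbit (axis i 2) = (\<Union>n\<in>{axis i 2}. centre_edge_orbit n)"
    by simp
  ultimately show ?thesis
    unfolding edges_F_without_def edges_F_eq by (simp only: centre_edge_orbits_diff)
qed

lemma realizations_F0:
  "q \<in> realizations edges_F0 p \<longleftrightarrow> det (fst q) \<noteq> 0 \<and> edge_preserving (q - p) (q + p)"
  unfolding edges_F0_eq realizations_centre_edge_orbits edge_preserving_diff_sum ball_short_edges
  by (simp add: of_int_vec_add of_int_vec_axis)

lemma realizations_F_without:
  "q \<in> realizations (edges_F_without i) p \<longleftrightarrow>
    q \<in> realizations edges_F0 p \<and> (\<forall>j. j \<noteq> i \<longrightarrow> stretch (q - p) (q + p) j = 0)"
proof -
  have "stretch (q - p) (q + p) j = 0 \<longleftrightarrow> norm (comb q (axis j 2) 1) = norm (comb p (axis j 2) 1)" for j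
    by (simp add: stretch_diff_sum)
  then show ?thesis
    unfolding edges_F0_eq edges_F_without_eq realizations_centre_edge_orbits
    by (auto simp: ball_Un of_int_vec_axis)
qed

section \<open>The expansive cone\<close>

text \<open>Up to the constant \<open>long_lengths p\<close>, these are the coordinates
  \<open>y\<close> on the deformation space.\<close>

definition long_lengths :: "'n::finite config \<Rightarrow> real ^ 'n" where
  "long_lengths q = (\<chi> i. (norm (comb q (axis i 2) 1))\<^sup>2)"

lemma stretch_eq_long_lengths_diff: "stretch (q' - q) (q' + q) i = long_lengths q' $ i - long_lengths q $ i"
  by (simp add: stretch_diff_sum long_lengths_def)

lemma has_derivative_norm_comb:
  "((\<lambda>q. (norm (comb q c s))\<^sup>2) has_derivative (\<lambda>w. 2 * (comb w c s \<bullet> comb q c s))) (at q)"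
  unfolding power2_norm_eq_inner
  by (auto intro!: derivative_eq_intros bounded_linear_imp_has_derivative[OF bounded_linear_comb]
      simp: inner_commute)

lemma has_derivative_long_lengths:
  fixes q :: "'n::finite config"
  shows "(long_lengths has_derivative (\<lambda>w. \<chi> i. 2 * stretch w q i)) (at q)"
proof (subst has_derivative_componentwise_within, intro ballI)
  fix b :: "real ^ 'n" assume "b \<in> Basis"
  then obtain k where b: "b = axis k 1"
    by (auto simp: Basis_vec_def)
  show "((\<lambda>q. long_lengths q \<bullet> b) has_derivative (\<lambda>w. (\<chi> i. 2 * stretch w q i) \<bullet> b)) (at q)"
    using has_derivative_norm_comb by (simp add: b inner_axis long_lengths_def stretch_def)
qed

lemma norm_comb_velocity:
  assumes "(\<gamma> has_vector_derivative w) (at t)"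
  shows "((\<lambda>t. (norm (comb (\<gamma> t) c s))\<^sup>2) has_real_derivative 2 * (comb w c s \<bullet> comb (\<gamma> t) c s)) (at t)"
  unfolding has_field_derivative_def
  by (rule has_derivative_eq_rhs[OF has_derivative_compose[OF
          assms[unfolded has_vector_derivative_def] has_derivative_norm_comb]])
    (simp add: fun_eq_iff comb_scaleR)

lemma constant_norm_comb_velocity:
  assumes "(\<gamma> has_vector_derivative w) (at 0)" "0 < e"
    "\<And>t. t \<in> {-e<..<e} \<Longrightarrow> norm (comb (\<gamma> t) c s) = norm (comb (\<gamma> 0) c s)"
  shows "comb w c s \<bullet> comb (\<gamma> 0) c s = 0"
proof -
  have "((\<lambda>t. (norm (comb (\<gamma> 0) c s))\<^sup>2) has_real_derivative 2 * (comb w c s \<bullet> comb (\<gamma> 0) c s)) (at 0)"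
  proof (rule has_field_derivative_transform_within_open[OF norm_comb_velocity[OF assms(1)]])
    show "(norm (comb (\<gamma> t) c s))\<^sup>2 = (norm (comb (\<gamma> 0) c s))\<^sup>2" if "t \<in> {-e<..<e}" for t
      by (simp only: assms(3)[OF that])
  qed (use assms(2) in auto)
  then have "2 * (comb w c s \<bullet> comb (\<gamma> 0) c s) = 0"
    by (rule DERIV_unique) simp
  then show ?thesis
    by simp
qed

lemma edge_preserving_velocity:
  assumes "(\<gamma> has_vector_derivative w) (at 0)" "0 < e" "\<gamma> 0 = p"
    "\<gamma> ` {-e<..<e} \<subseteq> realizations edges_F0 p"
  shows "edge_preserving w p"
proof -
  have "edge_preserving (\<gamma> t - p) (\<gamma> t + p)" if "t \<in> {-e<..<e}" for t
    using assms(4) that realizations_F0 by blast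
  then show ?thesis
    unfolding edge_preserving_diff_sum edge_preserving_def[of w]
    by (intro conjI allI impI constant_norm_comb_velocity[OF assms(1,2), unfolded assms(3)]) blast+
qed

lemma edge_preserving_add:
  "edge_preserving w p \<Longrightarrow> edge_preserving w' p \<Longrightarrow> edge_preserving (w + w') p"
  and edge_preserving_scaleR: "edge_preserving w p \<Longrightarrow> edge_preserving (a *\<^sub>R w) p"
  and edge_preserving_diff:
  "edge_preserving w p \<Longrightarrow> edge_preserving w' p \<Longrightarrow> edge_preserving (w - w') p"
  by (simp_all add: edge_preserving_def comb_add comb_diff comb_scaleR inner_add_left inner_diff_left)

lemma stretch_add: "stretch (w + w') p i = stretch w p i + stretch w' p i"
  and stretch_scaleR: "stretch (a *\<^sub>R w) p i = a * stretch w p i"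
  and stretch_diff: "stretch (w - w') p i = stretch w p i - stretch w' p i"
  by (simp_all add: stretch_def comb_add comb_diff comb_scaleR inner_add_left inner_diff_left)

lemma infinitesimal_rotation_edge_preserving:
  assumes "r \<in> infinitesimal_rotations p"
  shows "edge_preserving r p" "stretch r p i = 0"
  using comb_infinitesimal_rotation[OF assms] by (simp_all add: edge_preserving_def stretch_def)

text \<open>Compares two arbitrary realizations instead of one with \<open>p\<close>; this yields
  monotonicity between any two parameter values of a motion.\<close>

lemma edge_preserving_realizations_F0:
  assumes "q \<in> realizations edges_F0 p" "q' \<in> realizations edges_F0 p"
  shows "edge_preserving (q' - q) (q' + q)"
  using assms unfolding realizations_F0 edge_preserving_diff_sum by metis

lemma openin_centre_inside:
  "openin (top_of_set (realizations E p)) {q \<in> realizations E p. centre_inside q}"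
proof -
  have "{q \<in> realizations E p. centre_inside q} =
      realizations E p \<inter> {q. det (fst q) \<noteq> 0 \<and> centre_inside q}"
    using realizations_det by blast
  then show ?thesis
    using open_centre_inside openin_open by blast
qed

lemma long_lengths_congruent:
  assumes "q \<in> realizations E p" "congruent q q'"
  shows "long_lengths q = long_lengths q'"
  using assms(2) unfolding congruent_iff_norm_comb[OF realizations_det[OF assms(1)]]
  by (simp add: long_lengths_def)

lemma congruent_if_long_lengths_eq:
  assumes "q \<in> realizations edges_F0 p" "q' \<in> realizations edges_F0 p"
    "centre_inside q" "centre_inside q'" "long_lengths q = long_lengths q'"
  shows "congruent q q'"
  using assms norm_comb_eq[OF edge_preserving_realizations_F0[OF assms(1,2)] assms(3,4)]
  by (simp add: congruent_iff_norm_comb[OF realizations_det[OF assms(1)]] stretch_eq_long_lengths_diff)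

section \<open>Deformations with prescribed changes of the removed lengths\<close>

locale nondegenerate_config =
  fixes p :: "'n::finite config"
  assumes det_nonzero: "det (fst p) \<noteq> 0" and inside: "centre_inside p"
begin

lemma infinitesimal_rotation_iff:
  "w \<in> infinitesimal_rotations p \<longleftrightarrow> edge_preserving w p \<and> (\<forall>i. stretch w p i = 0)"
  using infinitesimal_rotation_edge_preserving
    unstretched_imp_infinitesimal_rotation[OF det_nonzero inside] by blast

text \<open>
  The antisymmetric part of the matrix component fixes the rotational freedom, and its symmetric
  part records the lengths of the edges, with those of the removed ones on the diagonal.
\<close>

lemma deformation_family:
  "\<exists>r>0. \<exists>\<phi>. \<phi> 0 = p \<and> smooth_on \<phi> (ball 0 r) \<and>
    (\<forall>u\<in>ball 0 r. \<phi> u \<in> realizations edges_F0 p \<and> centre_inside (\<phi> u) \<and>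
      long_lengths (\<phi> u) = long_lengths p + u)"
proof -
  let ?m = "\<lambda>i. fst p $ i"
  define L :: "'n config \<Rightarrow> 'n config"
    where "L q = ((\<chi> i j. fst q $ i \<bullet> ?m j - fst q $ j \<bullet> ?m i), 0)" for q
  define B :: "'n config \<Rightarrow> 'n config \<Rightarrow> 'n config" where "B q q' = ((\<chi> i j. comb q (axis i 1 + axis j 1) 1 \<bullet> comb q' (axis i 1 + axis j 1) 1),
    (\<chi> i. comb q (axis i 1) 1 \<bullet> comb q' (axis i 1) 1))" for q q'
  have L: "linear L"
    unfolding L_def by (rule linearI) (simp_all add: prod_eq_iff vec_eq_iff algebra_simps)
  have B: "bilinear B"
    unfolding bilinear_def B_def
    by (intro conjI allI; rule linearI)
      (simp_all add: prod_eq_iff vec_eq_iff comb_add comb_scaleR inner_add_left inner_add_right)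
  have B_sym: "B q q' = B q' q" for q q'
    by (simp add: B_def inner_commute)
  have inj: "h = 0" if h: "L h + 2 *\<^sub>R B p h = 0" for h
  proof -
    have LB: "fst h $ i \<bullet> ?m j - fst h $ j \<bullet> ?m i
        + 2 * (comb p (axis i 1 + axis j 1) 1 \<bullet> comb h (axis i 1 + axis j 1) 1) = 0" for i j
      using arg_cong[OF h, of "\<lambda>x. fst x $ i $ j"] by (simp add: L_def B_def)
    \<comment> \<open>Adding the equations for \<open>(i, j)\<close> and \<open>(j, i)\<close>
      cancels the antisymmetric contribution of \<open>L\<close>.\<close>
    have sym0: "comb h (axis i 1 + axis j 1) 1 \<bullet> comb p (axis i 1 + axis j 1) 1 = 0" for i j
      using LB[of i j] LB[of j i] by (simp add: inner_commute add.commute)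
    have "comb h (axis i 1) 1 \<bullet> comb p (axis i 1) 1 = 0" for i
      using arg_cong[OF h, of "\<lambda>x. snd x $ i"] by (simp add: L_def B_def inner_commute)
    then have ep: "edge_preserving h p" and st: "\<And>i. stretch h p i = 0"
      using sym0 sym0[of i i for i, unfolded axis_add_axis] by (simp_all add: edge_preserving_def stretch_def)
    have "h \<in> infinitesimal_rotations p"
      using ep st infinitesimal_rotation_iff by blast
    then obtain A where A: "linear A" "\<And>x y. A x \<bullet> y = - (x \<bullet> A y)"
      and hA: "h = (\<chi> k. A (fst p $ k), A (snd p))"
      by (auto simp: infinitesimal_rotations_def)
    \<comment> \<open>With the contribution of \<open>B\<close> gone, \<open>L h = 0\<close> says
      that \<open>A (?m k) \<bullet> ?m j\<close> is symmetric in \<open>k\<close> and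
      \<open>j\<close>. Skewness of \<open>A\<close> makes it antisymmetric as well, so it
      vanishes.\<close>
    have "A (?m k) = 0" for k
    proof (rule orthogonal_to_rows[OF det_nonzero])
      fix j
      have "A (?m k) \<bullet> ?m j - A (?m j) \<bullet> ?m k = 0"
        using LB[of k j] sym0[of k j]
        by (simp add: hA inner_commute)
      then show "A (?m k) \<bullet> ?m j = 0"
        using A(2)[of "?m j" "?m k"] by (simp add: inner_commute)
    qed
    moreover from this have "A (snd p) = 0"
    proof -
      obtain t where "snd p = (\<Sum>k\<in>UNIV. t $ k *\<^sub>R ?m k)"
        by (rule rows_span[OF det_nonzero])
      then show ?thesis
        by (simp add: linear_sum[OF A(1)] linear_cmul[OF A(1)] \<open>\<And>k. A (?m k) = 0\<close>)
    qed
    ultimately show ?thesis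
      by (simp add: hA prod_eq_iff vec_eq_iff)
  qed
  obtain V g where V: "open V" "L p + B p p \<in> V" and gp: "g (L p + B p p) = p"
    and g: "smooth_on g V" and sol: "\<And>y. y \<in> V \<Longrightarrow> L (g y) + B (g y) (g y) = y"
    by (rule quadratic_map_smooth_local_inverse[OF L B B_sym inj]) (assumption+, blast)
  \<comment> \<open>Only the diagonal of the prescribed matrix moves; the lengths of the remaining
    edges and the normalization of the rotation stay fixed.\<close>
  define D :: "real ^ 'n \<Rightarrow> 'n config" where "D u = ((\<chi> i j. if i = j then u $ i else 0), 0)" for u
  have "linear D"
    unfolding D_def by (rule linearI) (simp_all add: prod_eq_iff vec_eq_iff)
  then have D: "bounded_linear D"
    by (simp add: linear_conv_bounded_linear)
  define W where "W = V \<inter> g -` {q. det (fst q) \<noteq> 0 \<and> centre_inside q}"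
  have "open W"
    unfolding W_def using smooth_on_imp_continuous_on[OF g] V(1) open_centre_inside
    by (rule continuous_open_preimage)
  moreover have "continuous_on UNIV (\<lambda>u. L p + B p p + D u)"
    by (intro continuous_intros bounded_linear.continuous_on[OF D])
  ultimately have "open (UNIV \<inter> (\<lambda>u. L p + B p p + D u) -` W)"
    by (intro continuous_open_preimage) auto
  moreover have D0: "D 0 = 0"
    using \<open>linear D\<close> by (rule linear_0)
  then have "0 \<in> UNIV \<inter> (\<lambda>u. L p + B p p + D u) -` W"
    using V(2) det_nonzero inside by (simp add: W_def gp)
  ultimately obtain r where r: "r > 0" "ball 0 r \<subseteq> UNIV \<inter> (\<lambda>u. L p + B p p + D u) -` W"
    using open_contains_ball by blast
  define \<phi> where "\<phi> u = g (L p + B p p + D u)" for u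
  have "smooth_on \<phi> (ball 0 r)"
    unfolding \<phi>_def[abs_def] using r by (intro smooth_on_affine_compose[OF D _ _ g]) (auto simp: W_def)
  moreover have "\<phi> u \<in> realizations edges_F0 p \<and> centre_inside (\<phi> u) \<and>
      long_lengths (\<phi> u) = long_lengths p + u" if "u \<in> ball 0 r" for u
  proof -
    have u: "L p + B p p + D u \<in> V" "det (fst (\<phi> u)) \<noteq> 0" "centre_inside (\<phi> u)"
      using r(2) that by (auto simp: W_def \<phi>_def)
    have eq: "L (\<phi> u) + B (\<phi> u) (\<phi> u) = L p + B p p + D u"
      unfolding \<phi>_def by (rule sol[OF u(1)])
    define n where "n q i j = (norm (comb q (axis i 1 + axis j 1) 1))\<^sup>2" for q :: "'n config" and i j
    have n_sym: "n q i j = n q j i" for q i j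
      by (simp add: n_def add.commute)
    have "fst (\<phi> u) $ i \<bullet> ?m j - fst (\<phi> u) $ j \<bullet> ?m i + n (\<phi> u) i j
        = n p i j + (if i = j then u $ i else 0)" for i j
      using arg_cong[OF eq, of "\<lambda>x. fst x $ i $ j"]
      by (simp add: L_def B_def D_def n_def power2_norm_eq_inner inner_commute)
    \<comment> \<open>The first two summands are together antisymmetric in \<open>i\<close> and
      \<open>j\<close> while all other terms are symmetric, so adding the equations for
      \<open>(i, j)\<close> and \<open>(j, i)\<close> isolates \<open>n\<close>.\<close>
    then have n: "n (\<phi> u) i j = n p i j + (if i = j then u $ i else 0)" for i j
      using n_sym by (smt (verit))
    have "long_lengths (\<phi> u) = long_lengths p + u"
      using n[of i i for i] unfolding n_def axis_add_axis by (simp add: vec_eq_iff long_lengths_def)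
    moreover have "(norm (comb (\<phi> u) (axis i 1) 1))\<^sup>2 = (norm (comb p (axis i 1) 1))\<^sup>2" for i
      using arg_cong[OF eq, of "\<lambda>x. snd x $ i"]
      by (simp add: L_def B_def D_def power2_norm_eq_inner)
    moreover have "norm (comb (\<phi> u) (axis i 1 + axis j 1) 1) = norm (comb p (axis i 1 + axis j 1) 1)"
      if "i \<noteq> j" for i j
      using n[of i j] that by (simp add: n_def)
    ultimately show ?thesis
      using u by (simp add: realizations_F0 edge_preserving_diff_sum)
  qed
  moreover have "\<phi> 0 = p"
    by (simp add: \<phi>_def D0 gp)
  ultimately show ?thesis
    using r(1) by blast
qed

lemma has_degrees_of_freedom_F0: "has_degrees_of_freedom edges_F0 p TYPE(real ^ 'n)"
proof -
  obtain r \<phi> where r: "r > 0" and \<phi>: "\<phi> 0 = p" "smooth_on \<phi> (ball 0 r)"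
    "\<forall>u\<in>ball 0 r. \<phi> u \<in> realizations edges_F0 p \<and> centre_inside (\<phi> u) \<and>
      long_lengths (\<phi> u) = long_lengths p + u"
    using deformation_family by blast
  have "local_parametrization edges_F0 p (ball 0 r) \<phi>"
  \<comment> \<open>\<open>N\<close> keeps to the realizations with the centre inside, where
    \<open>congruent_if_long_lengths_eq\<close> applies.\<close>
  proof (rule local_parametrizationI[where N = "{q \<in> realizations edges_F0 p. centre_inside q}"
        and J = "\<lambda>q. long_lengths q - long_lengths p" and J' = "\<lambda>q w. \<chi> i. 2 * stretch w q i"])
    show "((\<lambda>q. long_lengths q - long_lengths p) has_derivative (\<lambda>w. \<chi> i. 2 * stretch w q i)) (at q)" for q
      using has_derivative_diff[OF has_derivative_long_lengths has_derivative_const] by simp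
    show "q' \<in> {q \<in> realizations edges_F0 p. centre_inside q}"
      if "q \<in> {q \<in> realizations edges_F0 p. centre_inside q}" "q' \<in> realizations edges_F0 p"
        "congruent q q'" for q q'
      using that centre_inside_congruent realizations_det by blast
    show "long_lengths q - long_lengths p = long_lengths q' - long_lengths p"
      if "q \<in> realizations edges_F0 p" "congruent q q'" for q q'
      using long_lengths_congruent[OF that] by simp
  qed (use r \<phi> congruent_if_long_lengths_eq[where p = p] in \<open>simp_all add: openin_centre_inside vec_eq_iff
      infinitesimal_rotation_edge_preserving image_subset_iff\<close>)
  then show ?thesis
    unfolding has_degrees_of_freedom_def by blast
qed

lemma expansive_one_dof_mechanism_F_without:
  "expansive_one_dof_mechanism (edges_F_without i) p"
proof -
  obtain r \<phi> where r: "r > 0" and \<phi>: "\<phi> 0 = p" "smooth_on \<phi> (ball 0 r)"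
    "\<forall>u\<in>ball 0 r. \<phi> u \<in> realizations edges_F0 p \<and> centre_inside (\<phi> u) \<and>
      long_lengths (\<phi> u) = long_lengths p + u"
    using deformation_family by blast
  \<comment> \<open>The \<open>i\<close>-th coordinate line of the family, along which only one
    removed length varies. The summand 0 gives the argument the affine form expected by
    \<open>smooth_on_affine_compose\<close>.\<close>
  define \<psi> where "\<psi> t = \<phi> (0 + t *\<^sub>R axis i 1)" for t :: real
  let ?R = "realizations (edges_F_without i) p"
  have ball: "0 + t *\<^sub>R axis i 1 \<in> ball (0 :: real ^ 'n) r" if "t \<in> {-r<..<r}" for t :: real
    using that by auto
  have \<psi>0: "\<psi> t \<in> realizations edges_F0 p" "centre_inside (\<psi> t)"
    "long_lengths (\<psi> t) = long_lengths p + t *\<^sub>R axis i 1" if "t \<in> {-r<..<r}" for t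
    using \<phi>(3)[rule_format, OF ball[OF that]] by (auto simp: \<psi>_def)
  have \<psi>R: "\<psi> t \<in> ?R" if "t \<in> {-r<..<r}" for t
    using \<psi>0[OF that] by (simp add: realizations_F_without stretch_eq_long_lengths_diff axis_def)
  have RF0: "q \<in> realizations edges_F0 p" and R_long: "j \<noteq> i \<Longrightarrow> long_lengths q $ j = long_lengths p $ j"
    if "q \<in> ?R" for q j
    using that by (simp_all add: realizations_F_without stretch_eq_long_lengths_diff)
  have "smooth_on \<psi> {-r<..<r}"
    unfolding \<psi>_def[abs_def]
    by (rule smooth_on_affine_compose[OF bounded_linear_scaleR_left _ ball \<phi>(2)]) auto
  moreover have "\<psi> 0 = p"
    by (simp add: \<psi>_def \<phi>(1))
  ultimately have "local_parametrization (edges_F_without i) p {-r<..<r} \<psi>"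
  proof (intro local_parametrizationI[where N = "{q \<in> ?R. centre_inside q}"
        and J = "\<lambda>q. long_lengths q $ i - long_lengths p $ i" and J' = "\<lambda>q w. 2 * stretch w q i"])
    show "((\<lambda>q. long_lengths q $ i - long_lengths p $ i) has_derivative (\<lambda>w. 2 * stretch w q i)) (at q)" for q
      unfolding long_lengths_def stretch_def
      using has_derivative_diff[OF has_derivative_norm_comb has_derivative_const] by simp
    show "congruent q q'" if "q \<in> {q \<in> ?R. centre_inside q}" "q' \<in> {q \<in> ?R. centre_inside q}"
      "long_lengths q $ i - long_lengths p $ i = long_lengths q' $ i - long_lengths p $ i" for q q'
    proof -
      have "long_lengths q $ j = long_lengths q' $ j" for j
        using that R_long[of q j] R_long[of q' j] by (cases "j = i") auto
      then show ?thesis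
        using that RF0 by (intro congruent_if_long_lengths_eq[where p = p]) (auto simp: vec_eq_iff)
    qed
    show "q' \<in> {q \<in> ?R. centre_inside q}"
      if "q \<in> {q \<in> ?R. centre_inside q}" "q' \<in> ?R" "congruent q q'" for q q'
      using that centre_inside_congruent realizations_det by blast
    show "long_lengths q $ i - long_lengths p $ i = long_lengths q' $ i - long_lengths p $ i"
      if "q \<in> ?R" "congruent q q'" for q q'
      using long_lengths_congruent[OF that] by simp
  qed (use r \<psi>0 \<psi>R in \<open>simp_all add: openin_centre_inside infinitesimal_rotation_edge_preserving
      image_subset_iff\<close>)
  moreover have "expansive_on {-r<..<r} \<psi>"
    unfolding expansive_on_def
  proof (intro allI mono_onI)
    fix a b and t t' :: real
    assume t: "t \<in> {-r<..<r}" "t' \<in> {-r<..<r}" "t \<le> t'"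
    show "dist (placement (\<psi> t) a) (placement (\<psi> t) b) \<le> dist (placement (\<psi> t') a) (placement (\<psi> t') b)"
    proof (rule dist_placement_mono)
      show "edge_preserving (\<psi> t' - \<psi> t) (\<psi> t' + \<psi> t)"
        using \<psi>0(1) t by (intro edge_preserving_realizations_F0)
      show "0 \<le> stretch (\<psi> t' - \<psi> t) (\<psi> t' + \<psi> t) j" for j
        using \<psi>0(3) t by (simp add: stretch_eq_long_lengths_diff axis_def)
    qed (use \<psi>0(2) t in auto)
  qed
  ultimately show ?thesis
    using r unfolding expansive_one_dof_mechanism_def expansive_parametrization_def by blast
qed

text \<open>Every first-order change of the removed lengths comes from an actual motion, so
  first-order deformations meet no obstruction to being integrated.\<close>

lemma deformation_with_stretch:
  "\<exists>e>0. \<exists>\<gamma> w. smooth_on \<gamma> {-e<..<e} \<and> \<gamma> 0 = p \<and> \<gamma> ` {-e<..<e} \<subseteq> realizations edges_F0 p \<and>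
    (\<gamma> has_vector_derivative w) (at 0) \<and> (\<forall>i. stretch w p i = y i)"
proof -
  obtain r \<phi> where r: "r > 0" and \<phi>: "\<phi> 0 = p" "smooth_on \<phi> (ball 0 r)"
    "\<forall>u\<in>ball 0 r. \<phi> u \<in> realizations edges_F0 p \<and> centre_inside (\<phi> u) \<and>
      long_lengths (\<phi> u) = long_lengths p + u"
    using deformation_family by blast
  \<comment> \<open>The factor 2 compensates for \<open>stretch\<close> being half the rate of
    change of \<open>long_lengths\<close>. In \<open>e\<close> the summand 1 covers the case
    \<open>v = 0\<close>.\<close>
  define v :: "real ^ 'n" where "v = (\<chi> i. 2 * y i)"
  define e where "e = r / (norm v + 1)"
  have nv: "norm v + 1 > 0"
    by (simp add: add_nonneg_pos)
  then have e: "e > 0"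
    using r by (simp add: e_def)
  define \<gamma> where "\<gamma> t = \<phi> (0 + t *\<^sub>R v)" for t :: real
  define w where "w = frechet_derivative \<phi> (at 0) v"
  have ball: "0 + t *\<^sub>R v \<in> ball 0 r" if "t \<in> {-e<..<e}" for t :: real
  proof -
    have "\<bar>t\<bar> * norm v \<le> \<bar>t\<bar> * (norm v + 1)"
      by (intro mult_left_mono) auto
    also have "\<dots> < e * (norm v + 1)"
      using that nv by (intro mult_strict_right_mono) auto
    also have "\<dots> = r"
      using nv by (simp add: e_def)
    finally show ?thesis
      by simp
  qed
  have smooth: "smooth_on \<gamma> {-e<..<e}"
    unfolding \<gamma>_def[abs_def]
    by (rule smooth_on_affine_compose[OF bounded_linear_scaleR_left _ ball \<phi>(2)]) auto
  have \<gamma>0: "\<gamma> 0 = p"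
    by (simp add: \<gamma>_def \<phi>(1))
  have \<phi>': "(\<phi> has_derivative frechet_derivative \<phi> (at 0)) (at 0)"
    using r by (intro smooth_on_imp_has_derivative[OF \<phi>(2)]) simp
  have "((\<lambda>t :: real. 0 + t *\<^sub>R v) has_derivative (\<lambda>h. h *\<^sub>R v)) (at 0)"
    by (auto intro!: derivative_eq_intros)
  from has_derivative_compose[OF this] \<phi>'
  have "(\<gamma> has_derivative (\<lambda>h. frechet_derivative \<phi> (at 0) (h *\<^sub>R v))) (at 0)"
    unfolding \<gamma>_def[abs_def] by simp
  then have vel: "(\<gamma> has_vector_derivative w) (at 0)"
    unfolding has_vector_derivative_def w_def
    using linear_cmul[OF has_derivative_linear[OF \<phi>']] by simp
  have "stretch w p i = y i" for i
  proof -
    have "((\<lambda>t. long_lengths p $ i + t * v $ i) has_real_derivative 2 * (comb w (axis i 2) 1 \<bullet> comb (\<gamma> 0) (axis i 2) 1)) (at 0)"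
    proof (rule has_field_derivative_transform_within_open[OF norm_comb_velocity[OF vel], of "{-e<..<e}"])
      fix t :: real assume "t \<in> {-e<..<e}"
      from \<phi>(3)[rule_format, OF ball[OF this]]
      have "long_lengths (\<gamma> t) = long_lengths p + t *\<^sub>R v"
        by (simp add: \<gamma>_def)
      from arg_cong[OF this, of "\<lambda>x. x $ i"]
      show "(norm (comb (\<gamma> t) (axis i 2) 1))\<^sup>2 = long_lengths p $ i + t * v $ i"
        by (simp add: long_lengths_def)
    qed (use e in auto)
    moreover have "((\<lambda>t. long_lengths p $ i + t * v $ i) has_real_derivative v $ i) (at 0)"
      by (auto intro!: derivative_eq_intros)
    ultimately have "2 * stretch w p i = v $ i"
      unfolding stretch_def \<gamma>0 by (rule DERIV_unique)
    then show ?thesis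
      by (simp add: v_def)
  qed
  moreover have "\<gamma> ` {-e<..<e} \<subseteq> realizations edges_F0 p"
    using \<phi>(3) ball by (auto simp: \<gamma>_def)
  ultimately show ?thesis
    using e smooth \<gamma>0 vel by blast
qed

section \<open>Tangent space, expansive cone and extremal rays\<close>

text \<open>An edge-preserving \<open>w\<close> and the velocity of a motion with the same stretches
  differ by an infinitesimal rotation, which the definition of the tangent space allows for.\<close>

lemma infinitesimal_deformation_iff:
  "w \<in> infinitesimal_deformations edges_F0 p \<longleftrightarrow> edge_preserving w p"
proof
  show "edge_preserving w p" if "w \<in> infinitesimal_deformations edges_F0 p"
  proof -
    obtain w' r e \<gamma> where "w = w' + r" "r \<in> infinitesimal_rotations p" "e > 0" "\<gamma> 0 = p"
      "\<gamma> ` {-e<..<e} \<subseteq> realizations edges_F0 p" "(\<gamma> has_vector_derivative w') (at 0)"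
      using \<open>w \<in> _\<close> unfolding infinitesimal_deformations_def by blast
    then show ?thesis
      using edge_preserving_velocity infinitesimal_rotation_edge_preserving(1) edge_preserving_add
      by metis
  qed
  show "w \<in> infinitesimal_deformations edges_F0 p" if "edge_preserving w p"
  proof -
    obtain e \<gamma> w' where e: "e > 0" "smooth_on \<gamma> {-e<..<e}" "\<gamma> 0 = p"
      "\<gamma> ` {-e<..<e} \<subseteq> realizations edges_F0 p" "(\<gamma> has_vector_derivative w') (at 0)"
      and w': "\<forall>i. stretch w' p i = stretch w p i"
      using deformation_with_stretch[of "stretch w p"] by blast
    have "w - w' \<in> infinitesimal_rotations p"
      unfolding infinitesimal_rotation_iff
      using edge_preserving_diff[OF that edge_preserving_velocity[OF e(5,1,3,4)]] w'
      by (simp add: stretch_diff)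
    moreover have "w = w' + (w - w')"
      by simp
    ultimately show ?thesis
      unfolding infinitesimal_deformations_def using e by blast
  qed
qed

lemma dist_placement_derivative_nonneg:
  assumes "edge_preserving w p" "\<And>i. 0 \<le> stretch w p i"
  shows "0 \<le> frechet_derivative (\<lambda>q. (dist (placement q a) (placement q b))\<^sup>2) (at p) w"
proof -
  obtain n s where s: "s = 0 \<or> s = 1"
    and d: "\<And>q. dist (placement q a) (placement q b) = norm (comb q (of_int_vec n) s)"
    using dist_placement[of a b] by blast
  have "0 \<le> 2 * (comb w (of_int_vec n) s \<bullet> comb p (of_int_vec n) s)"
    unfolding gram_variation_diag[OF assms(1)]
    by (intro add_nonneg_nonneg sum_nonneg mult_nonneg_nonneg[OF radius_velocity_nonneg[OF assms(1) inside assms(2)]]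
        mult_nonneg_nonneg[OF assms(2)] integral_coefficients_nonneg[OF s])
  then show ?thesis
    unfolding d frechet_derivative_at[OF has_derivative_norm_comb, symmetric] .
qed

text \<open>The ends of the removed edges are pairs of joints themselves, so nonnegative stretches
  are necessary; \<open>dist_placement_derivative_nonneg\<close> shows that they suffice.\<close>

lemma expansive_cone_iff:
  "w \<in> expansive_cone edges_F0 p \<longleftrightarrow> edge_preserving w p \<and> (\<forall>i. 0 \<le> stretch w p i)"
proof -
  have "0 \<le> stretch w p i"
    if "0 \<le> frechet_derivative (\<lambda>q. (dist (placement q (Centre 0)) (placement q (Lattice (0 + axis i 2))))\<^sup>2) (at p) w" for i
    using that unfolding dist_placement_Centre_Lattice
      frechet_derivative_at[OF has_derivative_norm_comb, symmetric]
    by (simp add: of_int_vec_axis stretch_def)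
  then show ?thesis
    unfolding expansive_cone_def mem_Collect_eq infinitesimal_deformation_iff
    using dist_placement_derivative_nonneg by blast
qed

text \<open>The nonnegative half of the \<open>i\<close>-th coordinate axis in the space of
  stretches, taken as a full preimage: like the cone, it contains all infinitesimal
  rotations.\<close>

definition axis_ray :: "'n \<Rightarrow> 'n config set" where
  "axis_ray i = {w. edge_preserving w p \<and> 0 \<le> stretch w p i \<and> (\<forall>j. j \<noteq> i \<longrightarrow> stretch w p j = 0)}"

text \<open>Stretches are coordinates on the edge-preserving velocities modulo infinitesimal
  rotations, so membership in a ray is proportionality of stretches.\<close>

lemma deformation_ray_iff:
  assumes "edge_preserving w p"
  shows "w' \<in> deformation_ray p w \<longleftrightarrow>
    edge_preserving w' p \<and> (\<exists>c\<ge>0. \<forall>i. stretch w' p i = c * stretch w p i)"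
proof
  assume "w' \<in> deformation_ray p w"
  then obtain c r where c: "w' = c *\<^sub>R w + r" "0 \<le> c" "r \<in> infinitesimal_rotations p"
    unfolding deformation_ray_def by blast
  then have "edge_preserving w' p"
    using assms by (simp add: infinitesimal_rotation_edge_preserving edge_preserving_add edge_preserving_scaleR)
  moreover have "stretch w' p i = c * stretch w p i" for i
    using c by (simp add: infinitesimal_rotation_edge_preserving stretch_add stretch_scaleR)
  ultimately show "edge_preserving w' p \<and> (\<exists>c\<ge>0. \<forall>i. stretch w' p i = c * stretch w p i)"
    using c(2) by blast
next
  assume "edge_preserving w' p \<and> (\<exists>c\<ge>0. \<forall>i. stretch w' p i = c * stretch w p i)"
  then obtain c where c: "edge_preserving w' p" "0 \<le> c" "\<forall>i. stretch w' p i = c * stretch w p i"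
    by blast
  then have "w' - c *\<^sub>R w \<in> infinitesimal_rotations p"
    using assms by (simp add: infinitesimal_rotation_iff edge_preserving_diff edge_preserving_scaleR
        stretch_diff stretch_scaleR)
  moreover have "w' = c *\<^sub>R w + (w' - c *\<^sub>R w)"
    by simp
  ultimately show "w' \<in> deformation_ray p w"
    unfolding deformation_ray_def using c(2) by blast
qed

lemma deformation_ray_eq_axis_ray:
  assumes "edge_preserving w p" "0 < stretch w p i" "\<And>j. j \<noteq> i \<Longrightarrow> stretch w p j = 0"
  shows "deformation_ray p w = axis_ray i"
proof (rule set_eqI)
  fix w'
  have "(\<exists>c\<ge>0. \<forall>j. stretch w' p j = c * stretch w p j) \<longleftrightarrow>
      0 \<le> stretch w' p i \<and> (\<forall>j. j \<noteq> i \<longrightarrow> stretch w' p j = 0)" (is "?L \<longleftrightarrow> ?R")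
  proof
    assume ?L
    then show ?R
      using assms(2,3) by (auto intro: less_imp_le)
  next
    assume R: ?R
    have "stretch w' p j = stretch w' p i / stretch w p i * stretch w p j" for j
      using R assms(2,3) by (cases "j = i") auto
    moreover have "0 \<le> stretch w' p i / stretch w p i"
      using R assms(2) by simp
    ultimately show ?L
      by blast
  qed
  then show "w' \<in> deformation_ray p w \<longleftrightarrow> w' \<in> axis_ray i"
    by (simp add: deformation_ray_iff[OF assms(1)] axis_ray_def)
qed

lemma exists_stretch: "\<exists>w. edge_preserving w p \<and> (\<forall>i. stretch w p i = y i)"
proof -
  obtain e \<gamma> w where "e > 0" "\<gamma> 0 = p" "\<gamma> ` {-e<..<e} \<subseteq> realizations edges_F0 p"
    "(\<gamma> has_vector_derivative w) (at 0)" "\<forall>i. stretch w p i = y i"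
    using deformation_with_stretch[of y] by blast
  then show ?thesis
    using edge_preserving_velocity by blast
qed

lemma axis_ray_face: "axis_ray i face_of expansive_cone edges_F0 p"
  unfolding face_of_def
proof (intro conjI ballI impI)
  show "axis_ray i \<subseteq> expansive_cone edges_F0 p"
    by (force simp: expansive_cone_iff axis_ray_def)
  show "convex (axis_ray i)"
    by (rule convexI)
      (simp add: axis_ray_def edge_preserving_add edge_preserving_scaleR stretch_add stretch_scaleR)
  fix a b x
  assume ab: "a \<in> expansive_cone edges_F0 p" "b \<in> expansive_cone edges_F0 p"
    and x: "x \<in> axis_ray i" "x \<in> open_segment a b"
  obtain u where u: "0 < u" "u < 1" "x = (1 - u) *\<^sub>R a + u *\<^sub>R b"
    using x(2) by (auto simp: in_segment)
  have "stretch a p j = 0 \<and> stretch b p j = 0" if "j \<noteq> i" for j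
  proof -
    have "(1 - u) * stretch a p j + u * stretch b p j = 0"
      using x(1) that u(3) by (simp add: axis_ray_def stretch_add stretch_scaleR)
    moreover have "0 \<le> (1 - u) * stretch a p j" "0 \<le> u * stretch b p j"
      using ab u by (simp_all add: expansive_cone_iff)
    ultimately show ?thesis
      using u by (simp add: add_nonneg_eq_0_iff)
  qed
  then show "a \<in> axis_ray i" "b \<in> axis_ray i"
    using ab by (simp_all add: axis_ray_def expansive_cone_iff)
qed

lemma extremal_rays_eq: "extremal_rays p (expansive_cone edges_F0 p) = range axis_ray"
proof (intro subset_antisym subsetI)
  fix R assume "R \<in> range axis_ray"
  then obtain i where R: "R = axis_ray i"
    by blast
  obtain w where w: "edge_preserving w p" "\<forall>j. stretch w p j = (if j = i then 1 else 0)"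
    using exists_stretch[of "\<lambda>j. if j = i then 1 else 0"] by blast
  then have "w \<in> expansive_cone edges_F0 p" "w \<notin> infinitesimal_rotations p"
    by (auto simp: expansive_cone_iff infinitesimal_rotation_iff)
  moreover have "R = deformation_ray p w"
    unfolding R using w by (intro deformation_ray_eq_axis_ray[symmetric]) auto
  moreover have "R face_of expansive_cone edges_F0 p"
    unfolding R by (rule axis_ray_face)
  ultimately show "R \<in> extremal_rays p (expansive_cone edges_F0 p)"
    unfolding extremal_rays_def by blast
next
  fix R assume "R \<in> extremal_rays p (expansive_cone edges_F0 p)"
  then obtain w where face: "R face_of expansive_cone edges_F0 p"
    and w: "edge_preserving w p" "\<And>i. 0 \<le> stretch w p i"
    and rot: "w \<notin> infinitesimal_rotations p" and R: "R = deformation_ray p w"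
    unfolding extremal_rays_def expansive_cone_iff by blast
  obtain i where "stretch w p i \<noteq> 0"
    using rot w(1) infinitesimal_rotation_iff by blast
  then have i: "0 < stretch w p i"
    using w(2)[of i] by simp
  obtain w1 where w1: "edge_preserving w1 p" "\<And>j. stretch w1 p j = (if j = i then stretch w p i else 0)"
    using exists_stretch[of "\<lambda>j. if j = i then stretch w p i else 0"] by blast
  \<comment> \<open>\<open>w1\<close> carries the \<open>i\<close>-th stretch of \<open>w\<close>
    and \<open>w - w1\<close> the others, so \<open>w\<close> is the midpoint of two elements of the
    cone. A ray that is a face contains \<open>?a\<close>, hence \<open>w1\<close> is proportional
    to \<open>w\<close> and \<open>w\<close> has no other stretch.\<close>
  let ?a = "2 *\<^sub>R w1" and ?b = "2 *\<^sub>R (w - w1)"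
  have "?a \<in> expansive_cone edges_F0 p" "?b \<in> expansive_cone edges_F0 p"
    using w w1 by (simp_all add: expansive_cone_iff edge_preserving_scaleR edge_preserving_diff
        stretch_scaleR stretch_diff)
  moreover have "w \<in> R"
    unfolding R deformation_ray_iff[OF w(1)] using w(1) by (auto intro!: exI[of _ 1])
  moreover have "w \<in> open_segment ?a ?b"
  proof -
    have "stretch ?a p i \<noteq> stretch ?b p i"
      using i w1(2)[of i] by (simp add: stretch_scaleR stretch_diff)
    then have "?a \<noteq> ?b"
      by metis
    moreover have "w = (1 - 1 / 2) *\<^sub>R ?a + (1 / 2) *\<^sub>R ?b"
      by simp
    ultimately show ?thesis
      unfolding in_segment by (intro conjI exI[of _ "1 / 2"]) simp_all
  qed
  ultimately have "?a \<in> R"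
    using face unfolding face_of_def by blast
  then obtain c where c: "\<And>j. 2 * stretch w1 p j = c * stretch w p j"
    unfolding R deformation_ray_iff[OF w(1)] stretch_scaleR by blast
  have "c = 2"
    using c[of i] i by (simp add: w1(2))
  then have "stretch w p j = 0" if "j \<noteq> i" for j
    using c[of j] that by (simp add: w1(2))
  then show "R \<in> range axis_ray"
    unfolding R using deformation_ray_eq_axis_ray[OF w(1) i] by blast
qed

lemma inj_axis_ray: "inj axis_ray"
proof (rule injI, rule ccontr)
  fix i j assume ij: "axis_ray i = axis_ray j" "i \<noteq> j"
  obtain w where w: "edge_preserving w p" "\<forall>k. stretch w p k = (if k = i then 1 else 0)"
    using exists_stretch[of "\<lambda>j. if j = i then 1 else 0"] by blast
  then have "w \<in> axis_ray i" "w \<notin> axis_ray j"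
    using ij(2) by (auto simp: axis_ray_def)
  then show False
    using ij(1) by blast
qed

text \<open>Holds for every expansive parametrization of the mechanism. Monotonicity of the one
  removed length gives its stretch the right sign; the immersion condition keeps it nonzero, since
  otherwise all stretches would vanish and \<open>w\<close> would be an infinitesimal
  rotation.\<close>

lemma expansive_velocity_ray:
  assumes "expansive_velocity (edges_F_without i) p w"
  shows "deformation_ray p w = axis_ray i"
proof -
  obtain e \<phi> where e: "0 < e" and par: "local_parametrization (edges_F_without i) p {-e<..<e} \<phi>"
    and ex: "expansive_on {-e<..<e} \<phi>" and w: "(\<phi> has_vector_derivative w) (at 0)"
    using assms unfolding expansive_velocity_def expansive_parametrization_def by blast
  have \<phi>0: "\<phi> 0 = p" and R: "\<And>t. t \<in> {-e<..<e} \<Longrightarrow> \<phi> t \<in> realizations (edges_F_without i) p"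
    and imm: "\<And>h. frechet_derivative \<phi> (at 0) h \<in> infinitesimal_rotations p \<Longrightarrow> h = 0"
    using par e unfolding local_parametrization_def by auto
  have ep: "edge_preserving w p"
    using R realizations_F_without by (intro edge_preserving_velocity[OF w e \<phi>0]) blast
  have zero: "stretch w p j = 0" if "j \<noteq> i" for j
  proof -
    have "norm (comb (\<phi> t) (axis j 2) 1) = norm (comb (\<phi> 0) (axis j 2) 1)" if "t \<in> {-e<..<e}" for t
      using R[OF that] \<open>j \<noteq> i\<close> by (simp add: realizations_F_without stretch_diff_sum \<phi>0)
    then show ?thesis
      using constant_norm_comb_velocity[OF w e, of "axis j 2" 1] by (simp add: stretch_def \<phi>0)
  qed
  have "0 \<le> stretch w p i"
  proof -
    have "mono_on {-e<..<e} (\<lambda>t. dist (placement (\<phi> t) (Centre 0)) (placement (\<phi> t) (Lattice (0 + axis i 2))))"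
      using ex unfolding expansive_on_def by blast
    then have "mono_on {-e<..<e} (\<lambda>t. norm (comb (\<phi> t) (axis i 2) 1))"
      unfolding dist_placement_Centre_Lattice by (simp add: of_int_vec_axis)
    then have "mono_on {-e<..<e} (\<lambda>t. (norm (comb (\<phi> t) (axis i 2) 1))\<^sup>2)"
      unfolding mono_on_def by (auto intro: power_mono)
    then have "0 \<le> 2 * (comb w (axis i 2) 1 \<bullet> comb (\<phi> 0) (axis i 2) 1)"
      using e by (intro mono_on_imp_deriv_nonneg[OF _ norm_comb_velocity[OF w]]) (auto simp: interior_open)
    then show ?thesis
      by (simp add: stretch_def \<phi>0)
  qed
  moreover have "stretch w p i \<noteq> 0"
  proof
    assume "stretch w p i = 0"
    then have "\<forall>j. stretch w p j = 0"
      using zero by metis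
    then have "w \<in> infinitesimal_rotations p"
      using ep infinitesimal_rotation_iff by blast
    moreover have "frechet_derivative \<phi> (at 0) = (\<lambda>h. h *\<^sub>R w)"
      using w frechet_derivative_at unfolding has_vector_derivative_def by metis
    ultimately have "1 = (0 :: real)"
      by (intro imm) simp
    then show False
      by simp
  qed
  ultimately show ?thesis
    using ep zero by (intro deformation_ray_eq_axis_ray) auto
qed

end

section \<open>The regular simplex and its centroid\<close>

lemma nondegenerate_simplex_configuration:
  fixes lam :: "'n::finite \<Rightarrow> real ^ 'n"
  assumes "regular_simplex_vertices CARD('n) (insert 0 (range lam))"
  shows "nondegenerate_config (simplex_configuration lam)"
proof
  have card: "card (insert 0 (range lam)) = CARD('n) + 1"
    and indep: "\<not> affine_dependent (insert 0 (range lam))"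
    using assms by (simp_all add: regular_simplex_vertices_def)
  \<comment> \<open>The count d + 1 leaves no room for coincidences: the origin is not among the
    periods, and the periods are distinct.\<close>
  have notin: "0 \<notin> range lam"
    using card card_image_le[of UNIV lam] by (auto simp: insert_absorb)
  then have "card (range lam) = CARD('n)"
    using card by simp
  then have "inj lam"
    by (intro eq_card_imp_inj_on) auto
  moreover have "independent (range lam)"
    using indep notin by (simp add: affine_dependent_iff_dependent)
  ultimately show "det (fst (simplex_configuration lam)) \<noteq> 0"
    using rows_independent_iff_det[of "\<chi> k. lam k"] by (simp add: simplex_configuration_def)
  \<comment> \<open>The centroid has equal coefficients, whose sum d / (d + 1) is below 1.\<close>
  have "comb (simplex_configuration lam) (\<chi> k. 1 / (real CARD('n) + 1)) 1 = 0"
    by (simp add: comb_def simplex_configuration_def scaleR_sum_right)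
  moreover have "coeff_sum (\<chi> k :: 'n. 1 / (real CARD('n) + 1)) < 1"
    by (simp add: coeff_sum_def)
  ultimately show "centre_inside (simplex_configuration lam)"
    unfolding centre_inside_def by (intro exI[of _ "\<chi> k. 1 / (real CARD('n) + 1)"]) auto
qed

theorem theorem6:
  fixes lam :: "'n::finite \<Rightarrow> real ^ 'n" and p :: "'n config"
  assumes "CARD('n) \<ge> 2"
    and "regular_simplex_vertices CARD('n) (insert 0 (range lam))"
    and "p = simplex_configuration lam"
  shows "(\<forall>i. expansive_one_dof_mechanism (edges_F_without i) p) \<and>
         has_degrees_of_freedom edges_F0 p TYPE(real ^ 'n) \<and>
         card (extremal_rays p (expansive_cone edges_F0 p)) = CARD('n) \<and>
         (\<forall>w. (\<forall>i. expansive_velocity (edges_F_without i) p (w i)) \<longrightarrow>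
            bij_betw (\<lambda>i. deformation_ray p (w i)) UNIV
              (extremal_rays p (expansive_cone edges_F0 p)))"
proof -
  interpret nondegenerate_config p
    unfolding assms(3) by (rule nondegenerate_simplex_configuration[OF assms(2)])
  have "bij_betw (\<lambda>i. deformation_ray p (w i)) UNIV (extremal_rays p (expansive_cone edges_F0 p))"
    if "\<forall>i. expansive_velocity (edges_F_without i) p (w i)" for w
  proof -
    have "(\<lambda>i. deformation_ray p (w i)) = axis_ray"
      using that expansive_velocity_ray by blast
    then show ?thesis
      by (simp add: extremal_rays_eq inj_axis_ray inj_on_imp_bij_betw)
  qed
  moreover have "card (extremal_rays p (expansive_cone edges_F0 p)) = CARD('n)"
    unfolding extremal_rays_eq by (rule card_image[OF inj_axis_ray])
  ultimately show ?thesis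
    using expansive_one_dof_mechanism_F_without has_degrees_of_freedom_F0 by blast
qed

end
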